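(* Let $V$ be Thompson's group $V$, and let $\|x\|$ denote the word length of $x\in V$ with respect to a fixed finite generating set of $V$. For $x\in V$ let $N(x)$ be the number of carets in each tree of the reduced tree-pair diagram of $x$, and let $B(x)$ be the number of clusters of the permutation of $x$. Then there exists a constant $K>0$ such that for every $x\in V$ $$ \frac{N(x)}{K}\;\leq\; \|x\|\;\leq\; K\bigl(N(x)+B(x)\log B(x)\bigr). $$
   Context: Thompson's group $V$ is the group of right-continuous bijections of $[0,1)$ that are given by tree-pair diagrams. A tree-pair diagram is a triple $(T_1,\sigma,T_2)$, where $T_1,T_2$ are finite rooted binary trees with the same number $n\ge 1$ of leaves, the leaves of each being numbered $1,\dots,n$ from left to right, and $\sigma\in\mathcal S_n$ is a permutation of $\{1,\dots,n\}$. Each node of a rooted binary tree corresponds to a dyadic interval: the root corresponds to $[0,1)$, and the left and right children of a node correspond to the left and right halves of its interval. The diagram $(T_1,\sigma,T_2)$ represents the bijection of $[0,1)$ that maps, for each $i$, the interval of the $i$-th leaf of $T_1$ onto the interval of the $\sigma(i)$-th leaf of $T_2$ by the increasing affine map. $V$ is finitely generated. A caret is an interior node of a tree together with its two edges to its children, so a tree with $n$ leaves has $n-1$ carets. A diagram is reduced if there is no $i$ such that leaves $i,i+1$ are the two children of a common node of $T_1$, $\sigma(i+1)=\sigma(i)+1$, and leaves $\sigma(i),\sigma(i)+1$ are the two children of a common node of $T_2$. Every element of $V$ has a unique reduced diagram. $N(x)$ is the number of carets in each of the two trees of the reduced diagram of $x$ (so $N(x)=0$ for the identity). A cluster of a permutation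 $\sigma\in\mathcal S_n$ is a maximal set of consecutive integers $\{i,i+1,\dots,i+k\}\subseteq\{1,\dots,n\}$ (with $k\ge 0$) such that $\sigma(i+j)=\sigma(i)+j$ for all $0\le j\le k$. $B(x)$ is the number of clusters of the permutation $\sigma$ in a diagram $(T_1,\sigma,T_2)$ representing $x$; it does not depend on the diagram chosen, so one may take the reduced diagram. The logarithm may be taken to be the natural logarithm (so $B(x)\log B(x)=0$ when $B(x)=1$). *)

theory Defs
  imports Complex_Main "HOL-Library.Tree" "HOL-Combinatorics.Permutations"
    "HOL-Algebra.Bij" "HOL-Algebra.Generated_Groups"
begin

text \<open>
  Finite rooted binary trees are values of type \<^typ>\<open>unit tree\<close>: \<^const>\<open>size\<close> counts the
  interior nodes (carets) and \<^const>\<open>size1\<close> the leaves. The root may itself be a leaf.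
\<close>

text \<open>
  The intervals of the leaves from left to right, when the root is given the interval from \<open>a\<close>
  to \<open>b\<close>. A pair \<open>(a, b)\<close> stands for the half-open interval \<open>{a..<b}\<close>.
\<close>

fun leaf_intervals :: "real \<Rightarrow> real \<Rightarrow> unit tree \<Rightarrow> (real \<times> real) list" where
  "leaf_intervals a b \<langle>\<rangle> = [(a, b)]"
| "leaf_intervals a b \<langle>l, _, r\<rangle> =
     leaf_intervals a ((a + b) / 2) l @ leaf_intervals ((a + b) / 2) b r"

text \<open>Leaves are numbered from 1, list positions from 0.\<close>

definition leaf_interval :: "unit tree \<Rightarrow> nat \<Rightarrow> real \<times> real" where
  "leaf_interval T i = leaf_intervals 0 1 T ! (i - 1)"

type_synonym diagram = "unit tree \<times> (nat \<Rightarrow> nat) \<times> unit tree"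

text \<open>
  \<^term>\<open>\<sigma> permutes {1..n}\<close> includes \<open>\<sigma> i = i\<close> outside \<open>{1..n}\<close>, so a permutation in \<open>S\<^sub>n\<close> is
  encoded by exactly one function.
\<close>

definition is_diagram :: "diagram \<Rightarrow> bool" where
  "is_diagram D = (case D of (T1, \<sigma>, T2) \<Rightarrow>
     size1 T1 = size1 T2 \<and> \<sigma> permutes {1..size1 T1})"

definition affine_onto :: "real \<times> real \<Rightarrow> real \<times> real \<Rightarrow> real \<Rightarrow> real" where
  "affine_onto I J x = fst J + (snd J - fst J) / (snd I - fst I) * (x - fst I)"

definition represents :: "diagram \<Rightarrow> (real \<Rightarrow> real) \<Rightarrow> bool" where
  "represents D f = (case D of (T1, \<sigma>, T2) \<Rightarrow>
     \<forall>i\<in>{1..size1 T1}. \<forall>x\<in>{fst (leaf_interval T1 i)..<snd (leaf_interval T1 i)}.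
       f x = affine_onto (leaf_interval T1 i) (leaf_interval T2 (\<sigma> i)) x)"

text \<open>
  Elements are bijections of \<open>{0..<1}\<close>, set to \<^const>\<open>undefined\<close> outside by \<^const>\<open>Bij\<close>;
  the product is composition. Right-continuity is not listed separately, because a map that is
  affine on each of finitely many half-open intervals \<open>{a..<b}\<close> covering \<open>{0..<1}\<close> is
  right-continuous.
\<close>

definition thompson_V :: "(real \<Rightarrow> real) monoid" where
  "thompson_V = (BijGroup {0..<1})
     \<lparr>carrier := {f \<in> Bij {0..<1}. \<exists>D. is_diagram D \<and> represents D f}\<rparr>"

text \<open>Leaves number \<open>i\<close> and \<open>i + 1\<close> are the two children of a common node.\<close>

fun sibling_leaves :: "unit tree \<Rightarrow> nat \<Rightarrow> bool" where
  "sibling_leaves \<langle>\<rangle> i = False"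
| "sibling_leaves \<langle>l, _, r\<rangle> i =
     (l = \<langle>\<rangle> \<and> r = \<langle>\<rangle> \<and> i = 1 \<or> sibling_leaves l i \<or>
      size1 l < i \<and> sibling_leaves r (i - size1 l))"

definition reduced :: "diagram \<Rightarrow> bool" where
  "reduced D = (case D of (T1, \<sigma>, T2) \<Rightarrow>
     \<not> (\<exists>i. sibling_leaves T1 i \<and> \<sigma> (i + 1) = \<sigma> i + 1 \<and> sibling_leaves T2 (\<sigma> i)))"

text \<open>Every element of \<open>V\<close> has a unique reduced diagram, so the description is proper there.\<close>

definition reduced_diagram :: "(real \<Rightarrow> real) \<Rightarrow> diagram" where
  "reduced_diagram x = (THE D. is_diagram D \<and> reduced D \<and> represents D x)"

definition num_carets :: "(real \<Rightarrow> real) \<Rightarrow> nat" where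
  "num_carets x = (case reduced_diagram x of (T1, \<sigma>, T2) \<Rightarrow> size T1)"

definition is_run :: "nat \<Rightarrow> (nat \<Rightarrow> nat) \<Rightarrow> nat set \<Rightarrow> bool" where
  "is_run n \<sigma> A = (\<exists>i k. A = {i..i + k} \<and> A \<subseteq> {1..n} \<and> (\<forall>j\<le>k. \<sigma> (i + j) = \<sigma> i + j))"

definition clusters :: "nat \<Rightarrow> (nat \<Rightarrow> nat) \<Rightarrow> nat set set" where
  "clusters n \<sigma> = {A. is_run n \<sigma> A \<and> (\<forall>A'. is_run n \<sigma> A' \<longrightarrow> A \<subseteq> A' \<longrightarrow> A' = A)}"

definition num_clusters :: "(real \<Rightarrow> real) \<Rightarrow> nat" where
  "num_clusters x = (case reduced_diagram x of (T1, \<sigma>, T2) \<Rightarrow> card (clusters (size1 T1) \<sigma>))"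

text \<open>
  Meaningful for \<open>x\<close> in the subgroup generated by \<open>S\<close>; for other \<open>x\<close> no such word exists.
\<close>

definition word_length :: "('a, 'b) monoid_scheme \<Rightarrow> 'a set \<Rightarrow> 'a \<Rightarrow> nat" where
  "word_length G S x =
     (LEAST n. \<exists>w. length w = n \<and> set w \<subseteq> S \<union> m_inv G ` S \<and> foldr (\<otimes>\<^bsub>G\<^esub>) w \<one>\<^bsub>G\<^esub> = x)"

end

theory Submission
  imports Defs
begin

text \<open>
  For \<open>x\<close> in V, call a node bad if \<open>x\<close> does not map its dyadic interval affinely onto a dyadic interval.
  The bad nodes are exactly the interior nodes of the first tree of the reduced diagram, so \<open>N(x)\<close> is
  their number. A bad node of \<open>f \<circ> g\<close> is either bad for \<open>g\<close> or moved by \<open>g\<close> to a bad node of \<open>f\<close>;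
  hence \<open>N\<close> is subadditive, which is the lower bound.

  For the upper bound, elements of V are viewed as pairs of trees with labelled leaves, and one tree is
  transformed into the other by finitely many kinds of local moves near the root, each of which is the
  action of a fixed element of V. Rotations flatten any tree into a right vine in linearly many
  moves, so linearly many moves rearrange a tree with a given leaf word into any other one with that
  word, up to cyclic rotation of the word. It remains to permute the \<open>B(x)\<close> blocks that correspond to
  the clusters. They are placed on one of three stacks that hang near the root, and a radix sort,
  which only moves top entries between stacks, takes \<open>O(B(x))\<close> moves in each of \<open>O(log B(x))\<close> passes.
\<close>

section \<open>Dyadic intervals and bad nodes\<close>

text \<open>
  A node of a binary tree is addressed by the list of its turns from the root, \<^const>\<open>True\<close> being right;
  \<open>pt p s\<close> is the point with parameter \<open>s\<close> of the dyadic interval of \<open>p\<close>.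
\<close>

fun pt :: "bool list \<Rightarrow> real \<Rightarrow> real" where
  "pt [] s = s"
| "pt (b # p) s = (of_bool b + pt p s) / 2"

lemma pt_append: "pt (p @ q) s = pt p (pt q s)"
  by (induction p) auto

lemma pt_in_unit: "s \<in> {0..<1} \<Longrightarrow> pt p s \<in> {0..<1}"
  by (induction p) auto

lemma pt_affine: "pt p s = pt p 0 + (pt p 1 - pt p 0) * s"
proof (induction p)
  case (Cons b p)
  show ?case
    by (simp only: pt.simps) (subst Cons.IH, simp add: field_simps)
qed auto

lemma pt_width: "pt p 1 - pt p 0 = 1 / 2 ^ length p"
  by (induction p) (auto simp: field_simps)

lemma pt_cancel: "pt p s = pt p t \<Longrightarrow> s = t"
  by (induction p) auto

text \<open>As the parameters lie in [0,1), the point fixes its first binary digit, so the addresses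
  agree turn by turn until one of them ends: dyadic intervals that meet are nested.\<close>

lemma pt_eq_imp_comparable:
  assumes "pt p s = pt q t" "s \<in> {0..<1}" "t \<in> {0..<1}"
  shows "(\<exists>r. q = p @ r \<and> s = pt r t) \<or> (\<exists>r. p = q @ r \<and> t = pt r s)"
  using assms(1)
proof (induction p arbitrary: q)
  case (Cons b p)
  show ?case
  proof (cases q)
    case (Cons c q')
    have "pt p s \<in> {0..<1}" "pt q' t \<in> {0..<1}"
      using assms pt_in_unit by blast+
    then have "b = c" "pt p s = pt q' t"
      using Cons.prems Cons by (cases b; cases c; auto)+
    then show ?thesis using Cons.IH[of q'] Cons by auto
  qed (use Cons.prems in auto)
qed auto

text \<open>Agreement at 0 makes the addresses comparable. After cancelling the common prefix, the
  map of the remaining address \<open>r\<close> is the identity; its slope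
  \<open>1 / 2 ^ length r\<close> is then 1, so \<open>r\<close> is empty.\<close>

lemma pt_fun_eqD:
  assumes "\<And>s. s \<in> {0..<1} \<Longrightarrow> pt p s = pt q s"
  shows "p = q"
proof -
  have *: "r = []" if "\<And>s. s \<in> {0..<1::real} \<Longrightarrow> s = pt r s" for r
  proof -
    have "pt r (1/2) - pt r 0 = (1/2) / 2 ^ length r"
      using pt_affine[of r "1/2"] pt_width[of r] by simp
    moreover have "pt r (1/2) - pt r 0 = 1/2" using that[of "1/2"] that[of 0] by simp
    ultimately have "(2::real) ^ length r = 1" by (simp add: field_simps)
    then show "r = []" using one_less_power[of "2::real" "length r"] by (cases r) (auto simp del: power_Suc)
  qed
  have "pt p 0 = pt q 0" using assms[of 0] by simp
  from pt_eq_imp_comparable[OF this] consider r where "q = p @ r" | r where "p = q @ r" by auto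
  then show ?thesis
  proof cases
    case 1
    have "s = pt r s" if "s \<in> {0..<1::real}" for s
      by (rule pt_cancel[of p]) (use assms[OF that] in \<open>simp only: 1 pt_append\<close>)
    with *[of r] show ?thesis using 1 by simp
  next
    case 2
    have "s = pt r s" if "s \<in> {0..<1::real}" for s
      by (rule pt_cancel[of q]) (use assms[OF that] in \<open>simp only: 2 pt_append\<close>)
    with *[of r] show ?thesis using 2 by simp
  qed
qed

text \<open>Equal parameters on both sides mean that \<open>f\<close> sends the interval of
  \<open>p\<close> onto that of \<open>q\<close> by the increasing affine map.\<close>

definition cmap :: "(real \<Rightarrow> real) \<Rightarrow> bool list \<Rightarrow> bool list \<Rightarrow> bool" where
  "cmap f p q \<longleftrightarrow> (\<forall>s\<in>{0..<1}. f (pt p s) = pt q s)"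

lemma cmap_append: "cmap f p q \<Longrightarrow> cmap f (p @ r) (q @ r)"
  using pt_in_unit unfolding cmap_def pt_append by blast

lemma cmap_unique: "cmap f p q \<Longrightarrow> cmap f p q' \<Longrightarrow> q = q'"
  unfolding cmap_def by (metis pt_fun_eqD)

lemma cmap_inj:
  assumes "inj_on f {0..<1}" "cmap f p q" "cmap f p' q"
  shows "p = p'"
proof (rule pt_fun_eqD)
  fix s :: real assume s: "s \<in> {0..<1}"
  then have "f (pt p s) = f (pt p' s)" using assms unfolding cmap_def by simp
  then show "pt p s = pt p' s" using assms(1) s pt_in_unit by (meson inj_onD)
qed

text \<open>Every point of an interval lies in one of its halves. This is used to see that a
  reducible pair of leaves has a parent that is not bad.\<close>

lemma cmap_children:
  assumes "cmap f (p @ [False]) (q @ [False])" "cmap f (p @ [True]) (q @ [True])"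
  shows "cmap f p q"
  unfolding cmap_def
proof
  fix s :: real assume s: "s \<in> {0..<1}"
  define b where "b \<longleftrightarrow> s \<ge> 1/2"
  define s' where "s' = 2 * s - of_bool b"
  have "s' \<in> {0..<1}" "s = pt [b] s'" using s by (auto simp: s'_def b_def)
  then show "f (pt p s) = pt q s"
    using assms unfolding cmap_def by (cases b) (metis pt_append)+
qed

lemma cmap_comp: "cmap g p q \<Longrightarrow> cmap f q r \<Longrightarrow> cmap (compose {0..<1} f g) p r"
  using pt_in_unit unfolding cmap_def compose_def by auto

definition bad :: "(real \<Rightarrow> real) \<Rightarrow> bool list set" where
  "bad f = {p. \<nexists>q. cmap f p q}"

text \<open>An affine map restricts to subintervals, so \<open>bad f\<close> is closed under
  ancestors, as the interior nodes of a tree are.\<close>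

lemma bad_prefix: "p @ r \<in> bad f \<Longrightarrow> p \<in> bad f"
  using cmap_append unfolding bad_def by blast

lemma bad_id: "bad (\<lambda>x\<in>{0..<1}. x) = {}"
  using pt_in_unit unfolding bad_def cmap_def by auto

text \<open>As \<open>g\<close> is injective, the nodes that are bad for the composite but not for
  \<open>g\<close> have distinct images among the bad nodes of \<open>f\<close>.\<close>

lemma bad_compose:
  assumes "inj_on g {0..<1}" "finite (bad f)" "finite (bad g)"
  shows "finite (bad (compose {0..<1} f g))"
    and "card (bad (compose {0..<1} f g)) \<le> card (bad f) + card (bad g)"
proof -
  let ?h = "compose {0..<1} f g"
  define E where "E = {p \<in> bad ?h. p \<notin> bad g}"
  define q where "q p = (SOME q. cmap g p q)" for p
  have q: "cmap g p (q p)" if "p \<in> E" for p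
    using that unfolding E_def q_def bad_def by (metis (mono_tags, lifting) mem_Collect_eq someI_ex)
  have inj: "inj_on q E"
    by (rule inj_onI) (metis assms(1) cmap_inj q)
  have im: "q ` E \<subseteq> bad f"
  proof clarify
    fix p assume p: "p \<in> E"
    show "q p \<in> bad f"
    proof (rule ccontr)
      assume "q p \<notin> bad f"
      then obtain r where "cmap f (q p) r" unfolding bad_def by auto
      then show False using p cmap_comp[OF q[OF p]] unfolding E_def bad_def by blast
    qed
  qed
  have finE: "finite E" using inj im assms(2) by (meson finite_imageD finite_subset)
  have sub: "bad ?h \<subseteq> E \<union> bad g" unfolding E_def by blast
  show "finite (bad ?h)" using sub finE assms(3) by (meson finite_Un finite_subset)
  have "card (bad ?h) \<le> card E + card (bad g)"
    using card_mono[OF _ sub] finE assms(3) card_Un_le[of E "bad g"] by fastforce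
  also have "card E \<le> card (bad f)" using inj im assms(2) by (metis card_inj_on_le)
  finally show "card (bad ?h) \<le> card (bad f) + card (bad g)" by simp
qed

section \<open>Trees as prefix codes\<close>

fun paths :: "unit tree \<Rightarrow> bool list list" where
  "paths \<langle>\<rangle> = [[]]"
| "paths \<langle>l, _, r\<rangle> = map (Cons False) (paths l) @ map (Cons True) (paths r)"

fun ints :: "unit tree \<Rightarrow> bool list set" where
  "ints \<langle>\<rangle> = {}"
| "ints \<langle>l, _, r\<rangle> = insert [] (Cons False ` ints l \<union> Cons True ` ints r)"

lemma length_paths [simp]: "length (paths T) = size1 T"
  by (induction T) auto

lemma distinct_paths: "distinct (paths T)"
  by (induction T) (auto simp: distinct_map)

lemma finite_ints: "finite (ints T)"
  by (induction T) auto

lemma card_ints: "card (ints T) = size T"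
proof (induction T)
  case (Node l x r)
  have "card (Cons False ` ints l \<union> Cons True ` ints r) = size l + size r"
    using Node by (subst card_Un_disjoint) (auto simp: finite_ints card_image)
  then show ?case
    by (subst ints.simps, subst card_insert_disjoint) (auto simp: finite_ints)
qed auto

lemma paths_cover: "x \<in> {0..<1} \<Longrightarrow> \<exists>p\<in>set (paths T). \<exists>s\<in>{0..<1}. x = pt p s"
proof (induction T arbitrary: x)
  case (Node l y r)
  show ?case
  proof (cases "x < 1/2")
    case True
    then have "2 * x \<in> {0..<1}" using Node.prems by auto
    from Node.IH(1)[OF this] obtain p s where
      "p \<in> set (paths l)" "s \<in> {0..<1}" "2 * x = pt p s" by blast
    then show ?thesis by (intro bexI[of _ "False # p"] bexI[of _ s]) auto
  next
    case False
    then have "2 * x - 1 \<in> {0..<1}" using Node.prems by auto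
    from Node.IH(2)[OF this] obtain p s where
      "p \<in> set (paths r)" "s \<in> {0..<1}" "2 * x - 1 = pt p s" by blast
    then show ?thesis by (intro bexI[of _ "True # p"] bexI[of _ s]) auto
  qed
qed auto

lemma paths_antichain: "p \<in> set (paths T) \<Longrightarrow> p @ r \<in> set (paths T) \<Longrightarrow> r = []"
  by (induction T arbitrary: p) auto

lemma paths_disjoint:
  assumes "p \<in> set (paths T)" "q \<in> set (paths T)" "pt p s = pt q t" "s \<in> {0..<1}" "t \<in> {0..<1}"
  shows "p = q"
proof -
  consider r where "q = p @ r" | r where "p = q @ r"
    using pt_eq_imp_comparable[OF assms(3-5)] by blast
  then show ?thesis using assms(1,2) paths_antichain by cases fastforce+
qed

lemma paths_not_ints: "p \<in> set (paths T) \<Longrightarrow> p \<notin> ints T"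
  by (induction T arbitrary: p) auto

lemma ints_or_below_leaf: "q \<in> ints T \<or> (\<exists>p\<in>set (paths T). \<exists>r. q = p @ r)"
proof (induction T arbitrary: q)
  case (Node l x r)
  show ?case
  proof (cases q)
    case (Cons b q')
    have "q' \<in> ints (if b then r else l) \<or>
        (\<exists>p\<in>set (paths (if b then r else l)). \<exists>r. q' = p @ r)"
      using Node.IH by simp
    then show ?thesis
    proof (elim disjE bexE exE)
      assume "q' \<in> ints (if b then r else l)"
      then show ?thesis using Cons by (cases b) auto
    next
      fix p s assume "p \<in> set (paths (if b then r else l))" "q' = p @ s"
      then have "b # p \<in> set (paths \<langle>l, x, r\<rangle>)" "q = (b # p) @ s" using Cons by (cases b; auto)+
      then show ?thesis by blast
    qed
  qed auto
qed auto

text \<open>Descending from the node through children that are not leaves ends at a caret with two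
  leaves; \<open>top\<close> is the case where the node is the root.\<close>

lemma ints_sibling_leaves:
  "p \<in> ints T \<Longrightarrow> \<exists>r. p @ r @ [False] \<in> set (paths T) \<and> p @ r @ [True] \<in> set (paths T)"
proof (induction T arbitrary: p)
  case (Node l x r)
  have top: "\<exists>r. r @ [False] \<in> set (paths T) \<and> r @ [True] \<in> set (paths T)" if "T \<noteq> \<langle>\<rangle>" for T
    using that
  proof (induction T)
    case (Node l x r)
    show ?case
    proof (cases "l = \<langle>\<rangle> \<and> r = \<langle>\<rangle>")
      case True
      then show ?thesis by (auto intro!: exI[of _ "[]"])
    next
      case False
      then consider "l \<noteq> \<langle>\<rangle>" | "r \<noteq> \<langle>\<rangle>" by blast
      then show ?thesis
      proof cases
        case 1
        then obtain q where "q @ [False] \<in> set (paths l)" "q @ [True] \<in> set (paths l)"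
          using Node by blast
        then show ?thesis by (intro exI[of _ "False # q"]) auto
      next
        case 2
        then obtain q where "q @ [False] \<in> set (paths r)" "q @ [True] \<in> set (paths r)"
          using Node by blast
        then show ?thesis by (intro exI[of _ "True # q"]) auto
      qed
    qed
  qed auto
  show ?case
  proof (cases p)
    case Nil
    then show ?thesis using top[of "\<langle>l, x, r\<rangle>"] by auto
  next
    case (Cons b p')
    then show ?thesis using Node.IH(1)[of p'] Node.IH(2)[of p'] Node.prems by (cases b) fastforce+
  qed
qed auto

lemma ints_inj: "ints T = ints U \<Longrightarrow> T = U"
proof (induction T arbitrary: U)
  case Leaf
  then show ?case by (cases U) auto
next
  case (Node l x r)
  then obtain l' y r' where U: "U = \<langle>l', y, r'\<rangle>" by (cases U) auto
  have *: "ints a = {p. False # p \<in> ints \<langle>a, z, b\<rangle>}"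
      "ints b = {p. True # p \<in> ints \<langle>a, z, b\<rangle>}"
    for a b :: "unit tree" and z
    by auto
  have "ints l = ints l'" using *(1)[of l x r] *(1)[of l' y r'] Node.prems U by metis
  moreover have "ints r = ints r'" using *(2) Node.prems U by metis
  ultimately show ?case using Node.IH U by simp
qed

text \<open>An interior node of one tree that is not interior in the other lies at or below a leaf
  there. It also has a common leaf strictly below it, against the antichain property.\<close>

lemma paths_eq_ints:
  assumes "set (paths T) = set (paths U)" shows "ints T = ints U"
proof -
  have "ints T \<subseteq> ints U" if "set (paths T) = set (paths U)" for T U
  proof
    fix p assume p: "p \<in> ints T"
    then obtain r where r: "p @ r @ [False] \<in> set (paths T)" using ints_sibling_leaves by blast
    show "p \<in> ints U"
    proof (rule ccontr)
      assume "p \<notin> ints U"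
      then obtain q r' where "q \<in> set (paths U)" "p = q @ r'" using ints_or_below_leaf by blast
      then have "r' @ r @ [False] = []" using r that paths_antichain[of q U] by auto
      then show False by simp
    qed
  qed
  with assms show ?thesis by blast
qed

lemma paths_inj: "set (paths T) = set (paths U) \<Longrightarrow> T = U"
  using paths_eq_ints ints_inj by blast

text \<open>Splitting by the first turn gives the two subtrees; each set of remainders is
  prefix-closed and smaller, because \<open>[]\<close> is lost.\<close>

lemma tree_of_prefix_closed:
  assumes "finite P" "\<And>p r. p @ r \<in> P \<Longrightarrow> p \<in> P"
  shows "\<exists>T. ints T = P"
  using assms
proof (induction "card P" arbitrary: P rule: less_induct)
  case less
  show ?case
  proof (cases "[] \<in> P")
    case False
    then have "P = {}" using less.prems(2)[of "[]"] by auto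
    then show ?thesis by (auto intro: exI[of _ "\<langle>\<rangle>"])
  next
    case True
    have "\<exists>T. ints T = {p. b # p \<in> P}" for b
    proof (rule less.hyps)
      have sub: "Cons b ` {p. b # p \<in> P} \<subseteq> P - {[]}" by auto
      have fin: "finite {p. b # p \<in> P}"
        using less.prems(1) sub by (meson finite_Diff finite_imageD finite_subset inj_onI list.inject)
      have "card {p. b # p \<in> P} = card (Cons b ` {p. b # p \<in> P})" by (simp add: card_image)
      also have "\<dots> \<le> card (P - {[]})" using less.prems(1) sub by (intro card_mono) auto
      also have "\<dots> < card P" using True less.prems(1) by (intro card_Diff1_less) auto
      finally show "card {p. b # p \<in> P} < card P" .
      show "finite {p. b # p \<in> P}" by fact
      show "p \<in> {p. b # p \<in> P}" if "p @ r \<in> {p. b # p \<in> P}" for p r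
        using that less.prems(2)[of "b # p" r] by auto
    qed
    then obtain l r where "ints l = {p. False # p \<in> P}" "ints r = {p. True # p \<in> P}" by metis
    then have "ints \<langle>l, (), r\<rangle> = insert [] {p \<in> P. p \<noteq> []}"
      by (auto simp: image_iff neq_Nil_conv) (metis (full_types))+
    then show ?thesis using True by (intro exI[of _ "\<langle>l, (), r\<rangle>"]) auto
  qed
qed

text \<open>The interior nodes have to be the proper prefixes of members of \<open>Q\<close>. By
  \<open>disj\<close> the members of \<open>Q\<close> are then leaves. By \<open>cover\<close> the
  left end of any leaf lies in a member of \<open>Q\<close>, which must be that leaf.\<close>

lemma tree_of_partition:
  assumes fin: "finite Q"
    and cover: "\<And>x. x \<in> {0..<1} \<Longrightarrow> \<exists>q\<in>Q. \<exists>s\<in>{0..<1}. x = pt q s"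
    and disj: "\<And>q r. q \<in> Q \<Longrightarrow> q @ r \<in> Q \<Longrightarrow> r = []"
  shows "\<exists>T. set (paths T) = Q"
proof -
  define P where "P = {p. \<exists>r. r \<noteq> [] \<and> p @ r \<in> Q}"
  have "P \<subseteq> (\<Union>q\<in>Q. (\<lambda>k. take k q) ` {..length q})"
  proof
    fix p assume "p \<in> P"
    then obtain r where "p @ r \<in> Q" unfolding P_def by auto
    then show "p \<in> (\<Union>q\<in>Q. (\<lambda>k. take k q) ` {..length q})"
      by (intro UN_I[of "p @ r"]) (auto simp: image_iff intro!: bexI[of _ "length p"])
  qed
  then have "finite P" by (rule finite_subset) (use fin in auto)
  moreover have "p \<in> P" if pr: "p @ r \<in> P" for p r
  proof -
    obtain s where "s \<noteq> []" "(p @ r) @ s \<in> Q" using pr unfolding P_def by blast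
    then have "r @ s \<noteq> []" "p @ (r @ s) \<in> Q" by simp_all
    then show ?thesis unfolding P_def by blast
  qed
  ultimately obtain T where T: "ints T = P" using tree_of_prefix_closed by metis
  have sub: "Q \<subseteq> set (paths T)"
  proof
    fix q assume q: "q \<in> Q"
    then have "q \<notin> ints T" using T disj unfolding P_def by auto
    then obtain p r where pr: "p \<in> set (paths T)" "q = p @ r" using ints_or_below_leaf by blast
    have "r = []" using pr q T paths_not_ints unfolding P_def by blast
    then show "q \<in> set (paths T)" using pr by simp
  qed
  moreover have "set (paths T) \<subseteq> Q"
  proof
    fix p assume p: "p \<in> set (paths T)"
    have "pt p 0 \<in> {0..<1}" by (rule pt_in_unit) auto
    then obtain q s where "q \<in> Q" "s \<in> {0..<1}" "pt p 0 = pt q s" using cover by blast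
    then show "p \<in> Q" using paths_disjoint[OF p, of q 0 s] sub by auto
  qed
  ultimately show ?thesis by blast
qed

section \<open>Reduced diagrams\<close>

text \<open>Passes from intervals to addresses. The starting interval is arbitrary because the
  recursion halves it.\<close>

lemma leaf_intervals_eq:
  "leaf_intervals a b T = map (\<lambda>p. (a + (b - a) * pt p 0, a + (b - a) * pt p 1)) (paths T)"
proof (induction T arbitrary: a b)
  case (Node l x r)
  have "a + ((a + b) / 2 - a) * t = a + (b - a) * (t / 2)"
    "(a + b) / 2 + (b - (a + b) / 2) * t = a + (b - a) * ((1 + t) / 2)" for t
    by (simp_all add: field_simps)
  then show ?case using Node by simp
qed simp

lemma leaf_interval_eq:
  assumes "i \<in> {1..size1 T}"
  shows "leaf_interval T i = (pt (paths T ! (i - 1)) 0, pt (paths T ! (i - 1)) 1)"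
  using assms unfolding leaf_interval_def leaf_intervals_eq by (subst nth_map) auto

text \<open>The formula with end points and the one with parameters describe the same affine map.
  The shift \<open>- 1\<close> reconciles leaf numbers, which start at 1, with list positions, which
  start at 0.\<close>

lemma represents_iff:
  assumes "is_diagram (T1, \<sigma>, T2)"
  shows "represents (T1, \<sigma>, T2) f \<longleftrightarrow>
    (\<forall>i\<in>{1..size1 T1}. cmap f (paths T1 ! (i - 1)) (paths T2 ! (\<sigma> i - 1)))"
proof -
  have aff: "(\<forall>x\<in>{pt p 0..<pt p 1}. f x = affine_onto (pt p 0, pt p 1) (pt q 0, pt q 1) x) \<longleftrightarrow>
    cmap f p q" for p q
  proof -
    have pos: "pt p 1 - pt p 0 > 0" by (simp add: pt_width)
    have img: "{pt p 0..<pt p 1} = pt p ` {0..<1}"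
    proof (intro equalityI subsetI)
      fix x assume x: "x \<in> {pt p 0..<pt p 1}"
      define s where "s = (x - pt p 0) / (pt p 1 - pt p 0)"
      have "s \<in> {0..<1}" using x pos by (auto simp: s_def field_simps)
      moreover have "x = pt p s" using pos by (subst pt_affine) (simp add: s_def)
      ultimately show "x \<in> pt p ` {0..<1}" by blast
    next
      fix x assume "x \<in> pt p ` {0..<1}"
      then obtain s where s: "s \<in> {0..<1}" "x = pt p s" by blast
      have "(pt p 1 - pt p 0) * s < (pt p 1 - pt p 0) * 1" "(pt p 1 - pt p 0) * s \<ge> 0"
        using s pos by (intro mult_strict_left_mono mult_nonneg_nonneg; simp)+
      then show "x \<in> {pt p 0..<pt p 1}" using s pt_affine[of p s] by auto
    qed
    have val: "affine_onto (pt p 0, pt p 1) (pt q 0, pt q 1) (pt p s) = pt q s" for s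
    proof -
      have "pt p s - pt p 0 = (pt p 1 - pt p 0) * s" using pt_affine[of p s] by simp
      then show ?thesis using pos pt_affine[of q s] unfolding affine_onto_def by simp
    qed
    show ?thesis unfolding img cmap_def by (simp add: val)
  qed
  have "\<sigma> i \<in> {1..size1 T2}" if "i \<in> {1..size1 T1}" for i
    using assms that permutes_in_image unfolding is_diagram_def by fastforce
  then show ?thesis
    unfolding represents_def by (simp add: leaf_interval_eq aff)
qed

lemma sibling_leaves_paths:
  "sibling_leaves T i \<Longrightarrow> \<exists>p. 1 \<le> i \<and> i < size1 T \<and>
     paths T ! (i - 1) = p @ [False] \<and> paths T ! i = p @ [True]"
proof (induction T arbitrary: i)
  case (Node l x r)
  consider "l = \<langle>\<rangle>" "r = \<langle>\<rangle>" "i = 1" | "sibling_leaves l i"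
    | "size1 l < i" "sibling_leaves r (i - size1 l)" using Node.prems by auto
  then show ?case
  proof cases
    case 2
    from Node.IH(1)[OF this] obtain p where "1 \<le> i" "i < size1 l"
     "paths l ! (i - 1) = p @ [False]" "paths l ! i = p @ [True]" by blast
    then show ?thesis by (intro exI[of _ "False # p"]) (auto simp: nth_append)
  next
    case 3
    from Node.IH(2)[OF this(2)] obtain p where p: "1 \<le> i - size1 l" "i - size1 l < size1 r"
     "paths r ! (i - size1 l - 1) = p @ [False]" "paths r ! (i - size1 l) = p @ [True]" by blast
    have "\<not> i - 1 < size1 l" "i - 1 - size1 l = i - size1 l - 1" using 3 by auto
    then show ?thesis using p 3 by (intro exI[of _ "True # p"]) (auto simp: nth_append)
  qed (auto intro: exI[of _ "[]"])
qed auto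

lemma paths_sibling_leaves:
  "p @ [False] \<in> set (paths T) \<Longrightarrow> p @ [True] \<in> set (paths T) \<Longrightarrow>
   \<exists>i. 1 \<le> i \<and> i < size1 T \<and> paths T ! (i - 1) = p @ [False] \<and> paths T ! i = p @ [True] \<and>
     sibling_leaves T i"
proof (induction T arbitrary: p)
  case (Node l x r)
  show ?case
  proof (cases p)
    case Nil
    then have "[] \<in> set (paths l)" "[] \<in> set (paths r)" using Node.prems by auto
    then have "l = \<langle>\<rangle>" "r = \<langle>\<rangle>" by (cases l; cases r; auto)+
    then show ?thesis using Nil by (intro exI[of _ 1]) auto
  next
    case (Cons b p')
    show ?thesis
    proof (cases b)
      case False
      then have "p' @ [False] \<in> set (paths l)" "p' @ [True] \<in> set (paths l)"
        using Node.prems Cons by auto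
      from Node.IH(1)[OF this] obtain i where i: "1 \<le> i" "i < size1 l"
        "paths l ! (i - 1) = p' @ [False]" "paths l ! i = p' @ [True]" "sibling_leaves l i" by blast
      then show ?thesis using Cons False by (intro exI[of _ i]) (auto simp: nth_append)
    next
      case True
      then have "p' @ [False] \<in> set (paths r)" "p' @ [True] \<in> set (paths r)"
        using Node.prems Cons by auto
      from Node.IH(2)[OF this] obtain i where i: "1 \<le> i" "i < size1 r"
        "paths r ! (i - 1) = p' @ [False]" "paths r ! i = p' @ [True]" "sibling_leaves r i" by blast
      then have "\<not> size1 l + i - 1 < size1 l" "size1 l + i - 1 - size1 l = i - 1" by auto
      then show ?thesis using Cons True i
        by (intro exI[of _ "size1 l + i"]) (auto simp: nth_append)
    qed
  qed
qed auto

section \<open>Existence and uniqueness of reduced diagrams\<close>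

lemma carrier_V: "carrier thompson_V = {f \<in> Bij {0..<1}. \<exists>D. is_diagram D \<and> represents D f}"
  by (simp add: thompson_V_def)

lemma Bij_inj: "f \<in> Bij S \<Longrightarrow> inj_on f S"
  by (simp add: Bij_def bij_betw_def)

lemma represents_cmap:
  assumes "is_diagram (T1, \<sigma>, T2)" "represents (T1, \<sigma>, T2) f" "p \<in> set (paths T1)"
  obtains i where "i \<in> {1..size1 T1}" "p = paths T1 ! (i - 1)" "cmap f p (paths T2 ! (\<sigma> i - 1))"
proof -
  obtain j where "j < size1 T1" "p = paths T1 ! j" using assms(3) by (metis in_set_conv_nth length_paths)
  then show thesis using that[of "Suc j"]
    assms(2)[unfolded represents_iff[OF assms(1)], rule_format, of "Suc j"] by simp
qed

lemma bad_subset_ints: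
  assumes "is_diagram (T1, \<sigma>, T2)" "represents (T1, \<sigma>, T2) f"
  shows "bad f \<subseteq> ints T1"
proof
  fix p assume p: "p \<in> bad f"
  show "p \<in> ints T1"
  proof (rule ccontr)
    assume "p \<notin> ints T1"
    then obtain q r where "q \<in> set (paths T1)" "p = q @ r" using ints_or_below_leaf by blast
    then have "q \<in> bad f" using p bad_prefix by blast
    moreover obtain i where "cmap f q (paths T2 ! (\<sigma> i - 1))"
      using represents_cmap[OF assms \<open>q \<in> set (paths T1)\<close>] by metis
    ultimately show False unfolding bad_def by blast
  qed
qed

lemma permutes_range:
  "\<sigma> permutes {1..n} \<Longrightarrow> i \<in> {1..n} \<Longrightarrow> 1 \<le> \<sigma> i \<and> \<sigma> i \<le> (n::nat)"
  using permutes_in_image[of \<sigma> "{1..n}" i] by simp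

lemma paths_nth_inj:
  assumes "i \<in> {1..size1 T}" "j \<in> {1..size1 T}" "paths T ! (i - 1) = paths T ! (j - 1)"
  shows "i = j"
proof -
  have "i - 1 = j - 1" using assms nth_eq_iff_index_eq[OF distinct_paths, of "i - 1" T "j - 1"] by auto
  then show ?thesis using assms by auto
qed

text \<open>Below an interior node of \<open>T1\<close> there is a caret with two leaves. If the
  node were not bad, the image of this caret would be a caret of \<open>T2\<close> with two leaves,
  matched in order, and the diagram could be reduced.\<close>

lemma reduced_ints:
  assumes "is_diagram (T1, \<sigma>, T2)" "represents (T1, \<sigma>, T2) f" "reduced (T1, \<sigma>, T2)"
  shows "ints T1 = bad f"
proof
  show "bad f \<subseteq> ints T1" by (rule bad_subset_ints[OF assms(1,2)])
  show "ints T1 \<subseteq> bad f"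
  proof
    fix p assume "p \<in> ints T1"
    then obtain r where r: "(p @ r) @ [False] \<in> set (paths T1)" "(p @ r) @ [True] \<in> set (paths T1)"
      using ints_sibling_leaves by fastforce
    then obtain i where i: "1 \<le> i" "i < size1 T1" "paths T1 ! (i - 1) = (p @ r) @ [False]"
      "paths T1 ! i = (p @ r) @ [True]" "sibling_leaves T1 i" using paths_sibling_leaves by blast
    have perm: "\<sigma> permutes {1..size1 T1}" "size1 T1 = size1 T2"
      using assms(1) unfolding is_diagram_def by auto
    have rng: "\<sigma> i \<in> {1..size1 T2}" "\<sigma> (i + 1) \<in> {1..size1 T2}"
      using permutes_range[OF perm(1), of i] permutes_range[OF perm(1), of "i + 1"] i perm by auto
    show "p \<in> bad f"
    proof (rule ccontr)
      assume "p \<notin> bad f"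
      then obtain q where q: "cmap f p q" unfolding bad_def by blast
      have rep: "\<And>j. j \<in> {1..size1 T1} \<Longrightarrow> cmap f (paths T1 ! (j - 1)) (paths T2 ! (\<sigma> j - 1))"
        using represents_iff[OF assms(1)] assms(2) by blast
      have e0: "paths T2 ! (\<sigma> i - 1) = (q @ r) @ [False]"
        using rep[of i] i cmap_append[OF q, of "r @ [False]"] cmap_unique by fastforce
      have e1: "paths T2 ! (\<sigma> (i + 1) - 1) = (q @ r) @ [True]"
        using rep[of "i + 1"] i cmap_append[OF q, of "r @ [True]"] cmap_unique by fastforce
      have "(q @ r) @ [False] \<in> set (paths T2)"
        unfolding e0[symmetric] by (rule nth_mem) (use rng in auto)
      moreover have "(q @ r) @ [True] \<in> set (paths T2)"
        unfolding e1[symmetric] by (rule nth_mem) (use rng in auto)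
      ultimately obtain j where j: "1 \<le> j" "j < size1 T2" "paths T2 ! (j - 1) = (q @ r) @ [False]"
        "paths T2 ! j = (q @ r) @ [True]" "sibling_leaves T2 j" using paths_sibling_leaves by blast
      have "j = \<sigma> i" by (rule paths_nth_inj[of _ T2]) (use j rng e0 in auto)
      moreover have "j + 1 = \<sigma> (i + 1)" by (rule paths_nth_inj[of _ T2]) (use j rng e1 in auto)
      ultimately show False using assms(3) i j unfolding reduced_def by auto
    qed
  qed
qed

text \<open>The first tree is determined by \<open>bad f\<close>. Then \<open>f\<close> determines
  the image of each leaf, hence the leaf set of the second tree and finally the permutation.\<close>

lemma reduced_unique:
  assumes "is_diagram (T1, \<sigma>, T2)" "represents (T1, \<sigma>, T2) f" "reduced (T1, \<sigma>, T2)"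
    and "is_diagram (U1, \<tau>, U2)" "represents (U1, \<tau>, U2) f" "reduced (U1, \<tau>, U2)"
  shows "(T1, \<sigma>, T2) = (U1, \<tau>, U2)"
proof -
  have "ints T1 = ints U1" using reduced_ints[OF assms(1-3)] reduced_ints[OF assms(4-6)] by simp
  then have 1: "T1 = U1" by (rule ints_inj)
  have perm: "\<sigma> permutes {1..size1 T1}" "size1 T1 = size1 T2"
    "\<tau> permutes {1..size1 T1}" "size1 T1 = size1 U2"
    using assms(1,4) 1 unfolding is_diagram_def by auto
  have eq: "paths T2 ! (\<sigma> i - 1) = paths U2 ! (\<tau> i - 1)" if "i \<in> {1..size1 T1}" for i
    using that assms(2,5) 1 cmap_unique
    unfolding represents_iff[OF assms(1)] represents_iff[OF assms(4)] by blast
  have set: "set (paths T) = (\<lambda>i. paths T ! (\<rho> i - 1)) ` {1..size1 T1}"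
    if "\<rho> permutes {1..size1 T1}" "size1 T1 = size1 T" for T \<rho>
  proof -
    have "(\<lambda>i. paths T ! (\<rho> i - 1)) ` {1..size1 T1} = (\<lambda>i. paths T ! (i - 1)) ` \<rho> ` {1..size1 T1}"
      by (simp add: image_image)
    also have "\<dots> = (\<lambda>i. paths T ! (i - 1)) ` {1..size1 T1}"
      by (simp only: permutes_image[OF that(1)])
    also have "\<dots> = (\<lambda>i. paths T ! (i - 1)) ` Suc ` {0..<size1 T}"
      by (simp add: that(2) atLeastLessThanSuc_atLeastAtMost)
    also have "\<dots> = set (paths T)"
      by (auto simp: image_image set_conv_nth simp del: image_Suc_atLeastLessThan)
    finally show ?thesis by simp
  qed
  have "set (paths T2) = set (paths U2)"
    unfolding set[OF perm(1,2)] set[OF perm(3,4)] using eq by (intro image_cong) auto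
  then have 2: "T2 = U2" by (rule paths_inj)
  have "\<sigma> i = \<tau> i" for i
  proof (cases "i \<in> {1..size1 T1}")
    case True
    show ?thesis by (rule paths_nth_inj[of _ T2])
      (use True eq 2 perm permutes_range[OF perm(1) True] permutes_range[OF perm(3) True] in auto)
  next
    case False
    then show ?thesis using perm(1,3) unfolding permutes_def by metis
  qed
  then show ?thesis using 1 2 by auto
qed

text \<open>Let the interior nodes of \<open>T1\<close> be the bad nodes. Its leaves are not bad,
  and their images under the bijection \<open>f\<close> partition [0,1) into dyadic intervals, which
  are the leaves of a tree \<open>T2\<close>.\<close>

lemma reduced_exists:
  assumes "f \<in> Bij {0..<1}" "finite (bad f)"
  shows "\<exists>T1 \<sigma> T2. is_diagram (T1, \<sigma>, T2) \<and> represents (T1, \<sigma>, T2) f \<and> reduced (T1, \<sigma>, T2)"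
proof -
  have inj: "inj_on f {0..<1}" and surj: "f ` {0..<1} = {0..<1}"
    using assms(1) by (auto simp: Bij_def bij_betw_def)
  obtain T1 where T1: "ints T1 = bad f" using tree_of_prefix_closed assms(2) bad_prefix by metis
  have "\<exists>q. cmap f p q" if "p \<in> set (paths T1)" for p
    using that paths_not_ints T1 unfolding bad_def by blast
  then obtain q where q: "cmap f p (q p)" if "p \<in> set (paths T1)" for p by metis
  have qinj: "inj_on q (set (paths T1))" by (rule inj_onI) (metis q cmap_inj[OF inj])
  have "\<exists>T2. set (paths T2) = q ` set (paths T1)"
  proof (rule tree_of_partition)
    fix x :: real assume "x \<in> {0..<1}"
    then obtain y where y: "y \<in> {0..<1}" "x = f y" using surj by blast
    then obtain p s where "p \<in> set (paths T1)" "s \<in> {0..<1}" "y = pt p s" using paths_cover by blast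
    then show "\<exists>q\<in>q ` set (paths T1). \<exists>s\<in>{0..<1}. x = pt q s"
      using q y unfolding cmap_def by blast
  next
    fix a r assume "a \<in> q ` set (paths T1)" "a @ r \<in> q ` set (paths T1)"
    then obtain p p' where p: "p \<in> set (paths T1)" "a = q p" "p' \<in> set (paths T1)" "a @ r = q p'"
      by blast
    \<comment> \<open>The left end of the interval of \<open>a @ r\<close> is a value of
      \<open>f\<close> on the intervals of both \<open>p\<close> and \<open>p'\<close>; injectivity
      makes the two arguments equal, so the leaves coincide.\<close>
    have r: "pt r 0 \<in> {0..<1}" by (rule pt_in_unit) auto
    then have "f (pt p (pt r 0)) = pt (q p) (pt r 0)" using q[OF p(1)] unfolding cmap_def by blast
    also have "\<dots> = pt (q p') 0" using p by (metis pt_append)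
    also have "\<dots> = f (pt p' 0)" using q[OF p(3)] unfolding cmap_def by simp
    finally have "pt p (pt r 0) = pt p' 0"
      by (rule inj_onD[OF inj]) (use r in \<open>auto intro!: pt_in_unit simp del: atLeastLessThan_iff\<close>, auto)
    then have "p = p'" by (rule paths_disjoint[OF p(1,3)]) (use r in auto)
    then show "r = []" using p by simp
  qed simp
  then obtain T2 where T2: "set (paths T2) = q ` set (paths T1)" by blast
  define n where "n = size1 T1"
  have n2: "size1 T2 = n"
    using distinct_card[OF distinct_paths, of T1] distinct_card[OF distinct_paths, of T2]
      T2 card_image[OF qinj] by (simp add: n_def)
  have "\<exists>j. j \<in> {1..n} \<and> paths T2 ! (j - 1) = q (paths T1 ! (i - 1))" if "i \<in> {1..n}" for i
  proof -
    have "q (paths T1 ! (i - 1)) \<in> set (paths T2)" unfolding T2 using that by (auto simp: n_def)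
    then obtain j where "j < n" "paths T2 ! j = q (paths T1 ! (i - 1))"
      using n2 by (metis in_set_conv_nth length_paths)
    then show ?thesis by (intro exI[of _ "Suc j"]) auto
  qed
  then obtain \<sigma>' where \<sigma>': "\<sigma>' i \<in> {1..n} \<and> paths T2 ! (\<sigma>' i - 1) = q (paths T1 ! (i - 1))"
    if "i \<in> {1..n}" for i by metis
  define \<sigma> where "\<sigma> i = (if i \<in> {1..n} then \<sigma>' i else i)" for i
  have "inj_on \<sigma>' {1..n}"
  proof (rule inj_onI)
    fix i j assume ij: "i \<in> {1..n}" "j \<in> {1..n}" "\<sigma>' i = \<sigma>' j"
    then have "q (paths T1 ! (i - 1)) = q (paths T1 ! (j - 1))" using \<sigma>' by metis
    then have "paths T1 ! (i - 1) = paths T1 ! (j - 1)"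
      by (rule inj_onD[OF qinj]) (use ij in \<open>auto simp: n_def\<close>)
    then show "i = j" using ij paths_nth_inj[of i T1 j] by (simp add: n_def)
  qed
  moreover have "\<sigma>' ` {1..n} \<subseteq> {1..n}" using \<sigma>' by blast
  ultimately have "bij_betw \<sigma>' {1..n} {1..n}" by (simp add: bij_betw_def endo_inj_surj)
  then have "bij_betw \<sigma> {1..n} {1..n}" by (rule bij_betw_cong[THEN iffD1, rotated]) (simp add: \<sigma>_def)
  then have perm: "\<sigma> permutes {1..n}" by (rule bij_imp_permutes) (unfold \<sigma>_def, rule if_not_P)
  have diag: "is_diagram (T1, \<sigma>, T2)" using perm n2 by (simp add: is_diagram_def n_def)
  have rep: "cmap f (paths T1 ! (i - 1)) (paths T2 ! (\<sigma> i - 1))" if "i \<in> {1..n}" for i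
    using \<sigma>'[OF that] that q[of "paths T1 ! (i - 1)"] by (auto simp: \<sigma>_def n_def)
  \<comment> \<open>The maps on a reducible pair of siblings fit together on their parent, which is
    then not bad; but the parent of a leaf of \<open>T1\<close> is an interior node, hence
    bad.\<close>
  have "reduced (T1, \<sigma>, T2)"
    unfolding reduced_def prod.case
  proof
    assume "\<exists>i. sibling_leaves T1 i \<and> \<sigma> (i + 1) = \<sigma> i + 1 \<and> sibling_leaves T2 (\<sigma> i)"
    then obtain i where i: "sibling_leaves T1 i" "\<sigma> (i + 1) = \<sigma> i + 1" "sibling_leaves T2 (\<sigma> i)"
      by blast
    obtain p where p: "1 \<le> i" "i < n" "paths T1 ! (i - 1) = p @ [False]" "paths T1 ! i = p @ [True]"
      using sibling_leaves_paths[OF i(1)] n_def by blast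
    obtain r where r: "paths T2 ! (\<sigma> i - 1) = r @ [False]" "paths T2 ! \<sigma> i = r @ [True]"
      using sibling_leaves_paths[OF i(3)] by blast
    have "cmap f (p @ [False]) (r @ [False])" using rep[of i] p(1-3) r(1) by simp
    moreover have "cmap f (p @ [True]) (r @ [True])" using rep[of "i + 1"] p(1,2,4) r(2) i(2) by simp
    ultimately have "cmap f p r" by (rule cmap_children)
    then have "p \<notin> ints T1" unfolding T1 bad_def by blast
    then obtain p' s where "p' \<in> set (paths T1)" "p = p' @ s" using ints_or_below_leaf by blast
    moreover have "p @ [False] \<in> set (paths T1)"
      unfolding p(3)[symmetric] by (rule nth_mem) (use p in \<open>auto simp: n_def\<close>)
    ultimately show False using paths_antichain[of p' T1 "s @ [False]"] by simp
  qed
  with diag rep show ?thesis using represents_iff[OF diag] n_def by blast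
qed

text \<open>Describes V without diagrams, so that closure under composition follows from
  \<open>bad_compose\<close>.\<close>

lemma V_iff_finite_bad: "f \<in> carrier thompson_V \<longleftrightarrow> f \<in> Bij {0..<1} \<and> finite (bad f)"
proof
  assume f: "f \<in> carrier thompson_V"
  then obtain T1 \<sigma> T2 where "is_diagram (T1, \<sigma>, T2)" "represents (T1, \<sigma>, T2) f"
    unfolding carrier_V by auto
  then have "finite (bad f)" using bad_subset_ints finite_ints finite_subset by metis
  with f show "f \<in> Bij {0..<1} \<and> finite (bad f)" unfolding carrier_V by blast
next
  assume "f \<in> Bij {0..<1} \<and> finite (bad f)"
  then show "f \<in> carrier thompson_V" using reduced_exists unfolding carrier_V by blast
qed

text \<open>Existence and uniqueness justify the definite description in
  \<open>reduced_diagram\<close>.\<close>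

lemma reduced_diagram_cases:
  assumes "f \<in> carrier thompson_V"
  obtains T1 \<sigma> T2 where "reduced_diagram f = (T1, \<sigma>, T2)" "is_diagram (T1, \<sigma>, T2)"
    "represents (T1, \<sigma>, T2) f" "ints T1 = bad f"
proof -
  obtain T1 \<sigma> T2 where D: "is_diagram (T1, \<sigma>, T2)" "represents (T1, \<sigma>, T2) f"
    "reduced (T1, \<sigma>, T2)" using assms reduced_exists V_iff_finite_bad by blast
  have "reduced_diagram f = (T1, \<sigma>, T2)"
    unfolding reduced_diagram_def
  proof (rule the_equality)
    fix D' assume "is_diagram D' \<and> reduced D' \<and> represents D' f"
    then show "D' = (T1, \<sigma>, T2)" using reduced_unique D by (cases D') blast
  qed (use D in blast)
  then show thesis using that D reduced_ints[OF D] by blast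
qed

section \<open>V as a group and subadditivity of the number of carets\<close>

lemma num_carets_eq: "f \<in> carrier thompson_V \<Longrightarrow> num_carets f = card (bad f)"
  by (erule reduced_diagram_cases) (simp add: num_carets_def flip: card_ints)

lemma V_mult: "f \<in> Bij {0..<1} \<Longrightarrow> g \<in> Bij {0..<1} \<Longrightarrow>
    f \<otimes>\<^bsub>thompson_V\<^esub> g = compose {0..<1} f g"
  by (simp add: thompson_V_def BijGroup_def)

lemma V_one: "\<one>\<^bsub>thompson_V\<^esub> = (\<lambda>x\<in>{0..<1}. x)"
  by (simp add: thompson_V_def BijGroup_def)

lemma cmap_inverse:
  assumes "f \<in> Bij {0..<1}" "cmap f p q"
  shows "cmap (\<lambda>x\<in>{0..<1}. inv_into {0..<1} f x) q p"
  unfolding cmap_def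
proof
  fix s :: real assume s: "s \<in> {0..<1}"
  then have "pt p s \<in> {0..<1}" "pt q s \<in> {0..<1}" "f (pt p s) = pt q s"
    using pt_in_unit assms(2) unfolding cmap_def by blast+
  then show "(\<lambda>x\<in>{0..<1}. inv_into {0..<1} f x) (pt q s) = pt p s"
    using inv_into_f_f[OF Bij_inj[OF assms(1)], of "pt p s"] by simp
qed

lemma V_subgroup: "subgroup (carrier thompson_V) (BijGroup {0..<1})"
proof (rule group.subgroupI)
  show "group (BijGroup {0..<1::real})" by (rule group_BijGroup)
  show "carrier thompson_V \<subseteq> carrier (BijGroup {0..<1})"
    unfolding carrier_V BijGroup_def by auto
  have "(\<lambda>x\<in>{0..<1}. x) \<in> carrier thompson_V"
    unfolding V_iff_finite_bad bad_id using id_Bij by simp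
  then show "carrier thompson_V \<noteq> {}" by blast
next
  fix f assume f: "f \<in> carrier thompson_V"
  then obtain T1 \<sigma> T2 where D: "is_diagram (T1, \<sigma>, T2)" "represents (T1, \<sigma>, T2) f"
    unfolding carrier_V by auto
  have fB: "f \<in> Bij {0..<1}" using f unfolding V_iff_finite_bad by blast
  let ?g = "\<lambda>x\<in>{0..<1}. inv_into {0..<1} f x"
  have perm: "\<sigma> permutes {1..size1 T1}" "size1 T1 = size1 T2"
    using D(1) unfolding is_diagram_def by auto
  \<comment> \<open>The diagram read backwards: as \<open>\<sigma>\<close> is onto, every leaf of
    \<open>T2\<close> is an image, and the inverse is affine on it.\<close>
  have "bad ?g \<subseteq> ints T2"
  proof
    fix r assume r: "r \<in> bad ?g"
    show "r \<in> ints T2"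
    proof (rule ccontr)
      assume "r \<notin> ints T2"
      then obtain q r' where q: "q \<in> set (paths T2)" "r = q @ r'" using ints_or_below_leaf by blast
      then obtain j where j: "j < size1 T2" "q = paths T2 ! j" by (metis in_set_conv_nth length_paths)
      have "Suc j \<in> \<sigma> ` {1..size1 T1}" using j perm permutes_image[OF perm(1)] by auto
      then obtain i where "i \<in> {1..size1 T1}" "\<sigma> i = Suc j" by auto
      then have "cmap f (paths T1 ! (i - 1)) q"
        using represents_iff[OF D(1)] D(2) j by fastforce
      from cmap_inverse[OF fB this] have "q \<notin> bad ?g" unfolding bad_def by blast
      then show False using r q bad_prefix by blast
    qed
  qed
  then have "finite (bad ?g)" using finite_ints finite_subset by blast
  then show "inv\<^bsub>BijGroup {0..<1}\<^esub> f \<in> carrier thompson_V"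
    unfolding V_iff_finite_bad inv_BijGroup[OF fB] using restrict_inv_into_Bij[OF fB] by simp
next
  fix f g assume fg: "f \<in> carrier thompson_V" "g \<in> carrier thompson_V"
  then have "f \<in> Bij {0..<1}" "g \<in> Bij {0..<1}" by (auto simp: V_iff_finite_bad)
  then show "f \<otimes>\<^bsub>BijGroup {0..<1}\<^esub> g \<in> carrier thompson_V"
    using bad_compose(1)[OF Bij_inj, of g f] compose_Bij fg
    by (auto simp: V_iff_finite_bad BijGroup_def)
qed

lemma group_V: "group thompson_V"
  using subgroup.subgroup_is_group[OF V_subgroup group_BijGroup] V_subgroup
  by (simp add: thompson_V_def)

lemma num_carets_mult:
  assumes "f \<in> carrier thompson_V" "g \<in> carrier thompson_V"
  shows "num_carets (f \<otimes>\<^bsub>thompson_V\<^esub> g) \<le> num_carets f + num_carets g"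
proof -
  have "f \<otimes>\<^bsub>thompson_V\<^esub> g \<in> carrier thompson_V"
    using assms group_V by (simp add: group.is_monoid monoid.m_closed)
  then show ?thesis
    using assms bad_compose(2)[OF Bij_inj, of g f] by (auto simp: num_carets_eq V_iff_finite_bad V_mult)
qed

lemma num_carets_one: "num_carets \<one>\<^bsub>thompson_V\<^esub> = 0"
proof -
  have "\<one>\<^bsub>thompson_V\<^esub> \<in> carrier thompson_V" using group_V by (simp add: group.is_monoid)
  then show ?thesis using num_carets_eq by (simp add: V_one bad_id)
qed

section \<open>Word length\<close>

context group
begin

lemma foldr_mult_closed: "set w \<subseteq> carrier G \<Longrightarrow> foldr (\<otimes>) w \<one> \<in> carrier G"
  by (induction w) auto

lemma foldr_mult_append:
  assumes "set v \<subseteq> carrier G" "set w \<subseteq> carrier G"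
  shows "foldr (\<otimes>) (v @ w) \<one> = foldr (\<otimes>) v \<one> \<otimes> foldr (\<otimes>) w \<one>"
  using assms(1) by (induction v) (auto simp: foldr_mult_closed assms(2) m_assoc simp del: foldr_append)

lemma word_length_le:
  assumes "set w \<subseteq> S \<union> m_inv G ` S"
  shows "word_length G S (foldr (\<otimes>) w \<one>) \<le> length w"
  unfolding word_length_def by (rule Least_le) (use assms in blast)

text \<open>Induction over \<open>generate\<close> produces some word, so the minimum in
  \<open>word_length\<close> is attained.\<close>

lemma word_exists:
  assumes "S \<subseteq> carrier G" "generate G S = carrier G" "x \<in> carrier G"
  obtains w where "set w \<subseteq> S \<union> m_inv G ` S" "foldr (\<otimes>) w \<one> = x" "length w = word_length G S x"
proof -
  have sub: "S \<union> m_inv G ` S \<subseteq> carrier G" using assms(1) by auto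
  have "x \<in> generate G S" using assms by simp
  then have "\<exists>w. set w \<subseteq> S \<union> m_inv G ` S \<and> foldr (\<otimes>) w \<one> = x"
  proof (induction rule: generate.induct)
    case one
    then show ?case by (intro exI[of _ "[]"]) auto
  next
    case (incl h)
    then show ?case using assms(1) by (intro exI[of _ "[h]"]) auto
  next
    case (inv h)
    then show ?case using assms(1) by (intro exI[of _ "[inv h]"]) auto
  next
    case (eng h1 h2)
    then obtain v w where "set v \<subseteq> S \<union> m_inv G ` S" "foldr (\<otimes>) v \<one> = h1"
      "set w \<subseteq> S \<union> m_inv G ` S" "foldr (\<otimes>) w \<one> = h2" by blast
    then show ?case using foldr_mult_append[of v w] sub
      by (intro exI[of _ "v @ w"]) (auto simp del: foldr_append)
  qed
  then have "\<exists>n w. length w = n \<and> set w \<subseteq> S \<union> m_inv G ` S \<and> foldr (\<otimes>) w \<one> = x" by blast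
  from LeastI_ex[OF this] show thesis using that unfolding word_length_def by blast
qed

lemma word_length_mult:
  assumes "S \<subseteq> carrier G" "generate G S = carrier G" "x \<in> carrier G" "y \<in> carrier G"
  shows "word_length G S (x \<otimes> y) \<le> word_length G S x + word_length G S y"
proof -
  obtain v where v: "set v \<subseteq> S \<union> m_inv G ` S" "foldr (\<otimes>) v \<one> = x" "length v = word_length G S x"
    using word_exists[OF assms(1-3)] .
  obtain w where w: "set w \<subseteq> S \<union> m_inv G ` S" "foldr (\<otimes>) w \<one> = y" "length w = word_length G S y"
    using word_exists[OF assms(1,2,4)] .
  have "S \<union> m_inv G ` S \<subseteq> carrier G" using assms(1) by auto
  then have "set v \<subseteq> carrier G" "set w \<subseteq> carrier G" using v(1) w(1) by blast+
  from foldr_mult_append[OF this] have "foldr (\<otimes>) (v @ w) \<one> = x \<otimes> y" using v(2) w(2) by simp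
  then show ?thesis using word_length_le[of "v @ w" S] v w by (simp del: foldr_append)
qed

lemma word_length_one: "word_length G S \<one> = 0"
  using word_length_le[of "[]" S] by simp

end

lemma num_carets_le_word_length:
  assumes "finite S" "S \<subseteq> carrier thompson_V" "generate thompson_V S = carrier thompson_V"
  shows "\<exists>C. \<forall>x\<in>carrier thompson_V. num_carets x \<le> C * word_length thompson_V S x"
proof -
  interpret V: group thompson_V by (rule group_V)
  let ?A = "S \<union> m_inv thompson_V ` S"
  have sub: "?A \<subseteq> carrier thompson_V" using assms(2) by auto
  \<comment> \<open>A sum over the finite alphabet bounds the number of carets of each letter; by
    subadditivity each letter of a word contributes at most \<open>C\<close>.\<close>
  define C where "C = (\<Sum>s\<in>?A. num_carets s)"
  have C: "num_carets s \<le> C" if "s \<in> ?A" for s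
    unfolding C_def using that assms(1) by (intro member_le_sum) auto
  have w: "num_carets (foldr (\<otimes>\<^bsub>thompson_V\<^esub>) w \<one>\<^bsub>thompson_V\<^esub>) \<le> C * length w"
    if "set w \<subseteq> ?A" for w
    using that
  proof (induction w)
    case (Cons s w)
    then have "num_carets s \<le> C" "s \<in> carrier thompson_V"
      "foldr (\<otimes>\<^bsub>thompson_V\<^esub>) w \<one>\<^bsub>thompson_V\<^esub> \<in> carrier thompson_V"
      using C sub V.foldr_mult_closed[of w] by auto
    then show ?case using Cons num_carets_mult by fastforce
  qed (simp add: num_carets_one)
  have "num_carets x \<le> C * word_length thompson_V S x" if "x \<in> carrier thompson_V" for x
    using V.word_exists[OF assms(2,3) that] w by metis
  then show ?thesis by blast
qed

section \<open>Moves on labelled trees\<close>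

text \<open>Only leaves carry labels; these take the place of the permutation of a diagram.\<close>

datatype 'a ltree = Lf 'a | Nd "'a ltree" "'a ltree"

fun labels :: "'a ltree \<Rightarrow> 'a list" where
  "labels (Lf a) = [a]"
| "labels (Nd l r) = labels l @ labels r"

abbreviation leaves :: "'a ltree \<Rightarrow> nat" where "leaves t \<equiv> length (labels t)"

lemma labels_nonempty [simp]: "labels t \<noteq> []"
  by (induction t) auto

text \<open>
  The first two rules and their inverses preserve the leaf order: they come from generators of
  Thompson's group F. In the last two rules \<open>a\<close>, \<open>b\<close> and \<open>Nd x c\<close> serve as stacks, and the top entry
  \<open>x\<close> of the third one is moved.
\<close>

inductive step :: "'a ltree \<Rightarrow> 'a ltree \<Rightarrow> bool" where
  rot: "step (Nd (Nd a b) c) (Nd a (Nd b c))"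
| rot': "step (Nd a (Nd (Nd b c) d)) (Nd a (Nd b (Nd c d)))"
| swap: "step (Nd a b) (Nd b a)"
| move1: "step (Nd a (Nd b (Nd x c))) (Nd (Nd x a) (Nd b c))"
| move2: "step (Nd a (Nd b (Nd x c))) (Nd a (Nd (Nd x b) c))"
| inverse: "step t u \<Longrightarrow> step u t"

definition reach :: "nat \<Rightarrow> 'a ltree \<Rightarrow> 'a ltree \<Rightarrow> bool" where
  "reach k t u \<longleftrightarrow> (\<exists>j\<le>k. (step ^^ j) t u)"

lemma reach_refl: "reach k t t"
  unfolding reach_def by (intro exI[of _ 0]) auto

lemma reach_step: "step t u \<Longrightarrow> reach 1 t u"
  unfolding reach_def by (intro exI[of _ 1]) auto

lemma reach_mono: "reach k t u \<Longrightarrow> k \<le> l \<Longrightarrow> reach l t u"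
  unfolding reach_def using le_trans by blast

lemma reach_trans: "reach k t u \<Longrightarrow> reach l u v \<Longrightarrow> reach (k + l) t v"
  unfolding reach_def by (metis add_mono relpowp_trans)

lemma reach_sym: "reach k t u \<Longrightarrow> reach k u t"
proof -
  have "(step ^^ j) t u \<Longrightarrow> (step ^^ j) u t" for j
  proof (induction j arbitrary: u)
    case (Suc j)
    then obtain v where "(step ^^ j) t v" "step v u" by auto
    then show ?case using Suc.IH step.inverse relpowp_Suc_I2 by metis
  qed auto
  then show "reach k t u \<Longrightarrow> reach k u t" unfolding reach_def by blast
qed

lemma reach_Cons: "step t u \<Longrightarrow> reach k u v \<Longrightarrow> reach (Suc k) t v"
  using reach_trans[OF reach_step] by fastforce

section \<open>Flattening trees to right vines\<close>

fun vine :: "'a list \<Rightarrow> 'a ltree" where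
  "vine [] = undefined"
| "vine [a] = Lf a"
| "vine (a # b # as) = Nd (Lf a) (vine (b # as))"

lemma vine_Cons: "as \<noteq> [] \<Longrightarrow> vine (a # as) = Nd (Lf a) (vine as)"
  by (cases as) auto

lemma labels_vine: "as \<noteq> [] \<Longrightarrow> labels (vine as) = as"
  by (induction as rule: vine.induct) auto

lemma vine_append: "bs \<noteq> [] \<Longrightarrow> vine (as @ bs) = foldr (\<lambda>a. Nd (Lf a)) as (vine bs)"
  by (induction as) (auto simp: vine_Cons)

text \<open>To reach \<open>u\<close>, each leaf of \<open>s\<close> is rotated into the left
  subtree and later back, which is why the hypothesis covers every \<open>t\<close>. Two rotations
  per leaf of \<open>s\<close> and one \<open>rot'\<close> per caret of \<open>s\<close> add up to
  \<open>3 * leaves s - 1\<close>.\<close>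

lemma reach_flatten_item:
  assumes "\<And>t. reach k (Nd t u) (Nd t v)"
  shows "reach (k + 3 * leaves s - 1) (Nd t (Nd s u)) (Nd t (foldr (\<lambda>a. Nd (Lf a)) (labels s) v))"
  using assms
proof (induction s arbitrary: k t u v)
  case (Lf a)
  have "reach (Suc (k + 1)) (Nd t (Nd (Lf a) u)) (Nd t (Nd (Lf a) v))"
    by (rule reach_Cons[OF step.inverse[OF rot]]) (rule reach_trans[OF Lf reach_step[OF rot]])
  then show ?case by simp
next
  case (Nd s1 s2)
  let ?k = "k + 3 * leaves s2 - 1"
  have pos: "leaves s1 > 0" "leaves s2 > 0" by simp_all
  have "reach (?k + 3 * leaves s1 - 1) (Nd t (Nd s1 (Nd s2 u)))
    (Nd t (foldr (\<lambda>a. Nd (Lf a)) (labels s1) (foldr (\<lambda>a. Nd (Lf a)) (labels s2) v)))"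
    by (intro Nd.IH Nd.prems)
  from reach_Cons[OF rot' this] have "reach (Suc (?k + 3 * leaves s1 - 1)) (Nd t (Nd (Nd s1 s2) u))
    (Nd t (foldr (\<lambda>a. Nd (Lf a)) (labels (Nd s1 s2)) v))" by simp
  moreover have "Suc (?k + 3 * leaves s1 - 1) \<le> k + 3 * leaves (Nd s1 s2) - 1"
  proof -
    have "Suc (k + 3 * y - 1 + 3 * x - 1) \<le> k + 3 * (x + y) - 1" if "0 < x" "0 < y" for x y :: nat
      using that by arith
    from this[OF pos] show ?thesis by simp
  qed
  ultimately show ?case by (rule reach_mono)
qed

text \<open>Induction along the right spine, for all left subtrees at once;
  \<open>reach_flatten_item\<close> treats the tree \<open>s\<close> that hangs off the
  spine.\<close>

lemma reach_flatten_right: "reach (3 * leaves u) (Nd t u) (Nd t (vine (labels u)))"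
proof (induction u arbitrary: t)
  case (Nd s u)
  have "reach (3 * leaves u + 3 * leaves s - 1) (Nd t (Nd s u)) (Nd t (vine (labels s @ labels u)))"
    unfolding vine_append[OF labels_nonempty] by (rule reach_flatten_item) (rule Nd(2))
  then show ?case by (auto elim!: reach_mono)
qed (simp add: reach_refl)

text \<open>Each \<open>rot\<close> passes the right part of the left subtree over to the right,
  until only the leftmost leaf remains.\<close>

lemma reach_leaf_left:
  "\<exists>a u. reach (leaves s) (Nd s v) (Nd (Lf a) u) \<and> a # labels u = labels s @ labels v"
proof (induction s arbitrary: v)
  case (Lf a)
  then show ?case using reach_refl by fastforce
next
  case (Nd s1 s2)
  obtain a u where "reach (leaves s1) (Nd s1 (Nd s2 v)) (Nd (Lf a) u)"
    "a # labels u = labels s1 @ labels (Nd s2 v)" using Nd.IH(1) by blast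
  moreover have "Suc (leaves s1) \<le> leaves (Nd s1 s2)"
    by (cases "labels s2") auto
  ultimately show ?case
    by (intro exI[of _ a] exI[of _ u] conjI)
      (use reach_Cons[OF rot, of "leaves s1" s1 s2 v] reach_mono in \<open>blast, simp\<close>)
qed

text \<open>The left subtree is cut down to a leaf with at most one move per leaf; then the right
  subtree is flattened with three moves per leaf.\<close>

lemma reach_vine: "reach (4 * leaves t) t (vine (labels t))"
proof (cases t)
  case (Nd s v)
  obtain a u where u: "reach (leaves s) (Nd s v) (Nd (Lf a) u)" "a # labels u = labels s @ labels v"
    using reach_leaf_left[of s v] by blast
  have "labels t = a # labels u" using Nd u by simp
  moreover from this have "vine (labels t) = Nd (Lf a) (vine (labels u))" by (simp add: vine_Cons)
  moreover have "leaves s + leaves v = Suc (leaves u)" using arg_cong[OF u(2), of length] by simp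
  ultimately show ?thesis
    using reach_trans[OF u(1) reach_flatten_right] Nd
    by (auto elim!: reach_mono)
qed (simp add: reach_refl)

text \<open>Both trees flatten to the same vine, and moves are reversible.\<close>

lemma reach_same_labels:
  assumes "labels t = labels u"
  shows "reach (8 * leaves t) t u"
proof -
  have "reach (4 * leaves t) (vine (labels t)) u" using reach_sym[OF reach_vine[of u]] assms by simp
  from reach_trans[OF reach_vine this] show ?thesis by simp
qed

text \<open>Bring the cut between \<open>as\<close> and \<open>bs\<close> to the root, swap, and
  rearrange. This takes \<open>8 + 8\<close> moves per leaf and a single swap, which is rounded up
  to one more per leaf.\<close>

lemma reach_rotate:
  assumes "labels t = as @ bs" "labels u = bs @ as" "as \<noteq> []" "bs \<noteq> []"
  shows "reach (17 * leaves t) t u"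
proof -
  have 1: "reach (8 * leaves t) t (Nd (vine as) (vine bs))"
    by (rule reach_same_labels) (simp add: assms labels_vine)
  have 2: "reach (8 * leaves u) (Nd (vine bs) (vine as)) u"
    using reach_same_labels[of "Nd (vine bs) (vine as)" u] assms by (simp add: labels_vine)
  have "reach (8 * leaves t + (1 + 8 * leaves u)) t u"
    using reach_trans[OF 1 reach_trans[OF reach_step[OF swap] 2]] .
  moreover have "leaves t = length as + length bs" "leaves u = length as + length bs" "as \<noteq> []"
    using assms by auto
  moreover from this have "length as \<ge> 1" by (cases as) auto
  ultimately show ?thesis by (auto elim!: reach_mono)
qed

section \<open>Three stacks and radix sort\<close>

abbreviation stack :: "'a ltree list \<Rightarrow> 'a ltree \<Rightarrow> 'a ltree" where
  "stack xs p \<equiv> foldr Nd xs p"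

lemma labels_stack: "labels (stack xs p) = concat (map labels xs) @ labels p"
  by (induction xs) auto

context
  fixes g :: "nat \<Rightarrow> 'a ltree" and p q r :: "'a ltree"
begin

text \<open>Stacks are lists of numbers, top first. The function \<open>g\<close> gives the subtree
  that a number stands for, so that sorting compares numbers while moves carry trees;
  \<open>p\<close>, \<open>q\<close>, \<open>r\<close> are the bottoms.\<close>

definition stacks :: "nat list \<Rightarrow> nat list \<Rightarrow> nat list \<Rightarrow> 'a ltree" where
  "stacks as bs cs = Nd (stack (map g as) p) (Nd (stack (map g bs) q) (stack (map g cs) r))"

lemma reach_pop1: "reach (length as) (stacks (as @ as') bs cs) (stacks as' bs (rev as @ cs))"
proof (induction as arbitrary: cs)
  case (Cons a as)
  have "step (stacks ((a # as) @ as') bs cs) (stacks (as @ as') bs (a # cs))"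
    unfolding stacks_def by (simp add: step.inverse[OF move1])
  from reach_Cons[OF this Cons] show ?case by simp
qed (simp add: reach_refl)

lemma reach_pop2: "reach (length bs) (stacks as (bs @ bs') cs) (stacks as bs' (rev bs @ cs))"
proof (induction bs arbitrary: cs)
  case (Cons b bs)
  have "step (stacks as ((b # bs) @ bs') cs) (stacks as (bs @ bs') (b # cs))"
    unfolding stacks_def by (simp add: step.inverse[OF move2])
  from reach_Cons[OF this Cons] show ?case by simp
qed (simp add: reach_refl)

lemma reach_distribute:
  "reach (length cs) (stacks as bs (cs @ cs'))
     (stacks (rev (filter (\<lambda>x. \<not> P x) cs) @ as) (rev (filter P cs) @ bs) cs')"
proof (induction cs arbitrary: as bs)
  case (Cons c cs)
  have "step (stacks as bs ((c # cs) @ cs'))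
      (stacks (if P c then as else c # as) (if P c then c # bs else bs) (cs @ cs'))"
    unfolding stacks_def by (auto intro: move1 move2)
  from reach_Cons[OF this Cons] show ?case by (cases "P c") auto
qed (simp add: reach_refl)

text \<open>Distribution reverses both parts and popping restores their order, so the partition is
  stable. The second stack is popped first, which puts the entries satisfying \<open>P\<close>
  deepest. Each entry moves twice.\<close>

lemma reach_partition:
  "reach (2 * length cs) (stacks [] [] cs) (stacks [] [] (filter (\<lambda>x. \<not> P x) cs @ filter P cs))"
proof -
  let ?a = "filter (\<lambda>x. \<not> P x) cs" and ?b = "filter P cs"
  have 1: "reach (length cs) (stacks [] [] cs) (stacks (rev ?a) (rev ?b) [])"
    using reach_distribute[of cs "[]" "[]" "[]" P] by simp
  have 2: "reach (length ?b) (stacks (rev ?a) (rev ?b) []) (stacks (rev ?a) [] ?b)"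
    using reach_pop2[of "rev ?b" "rev ?a" "[]" "[]"] by simp
  have 3: "reach (length ?a) (stacks (rev ?a) [] ?b) (stacks [] [] (?a @ ?b))"
    using reach_pop1[of "rev ?a" "[]" "[]" ?b] by simp
  have "length ?b + length ?a = length cs" using sum_length_filter_compl[of P cs] by simp
  then show ?thesis using reach_trans[OF 1 reach_trans[OF 2 3]] by (simp add: mult_2)
qed

text \<open>Radix sort: pass number \<open>k\<close> distributes the entries according to bit \<open>k\<close>.\<close>

lemma reach_radix:
  "\<exists>cs'. reach (2 * length cs * k) (stacks [] [] cs) (stacks [] [] cs') \<and> mset cs' = mset cs \<and>
     sorted_wrt (\<lambda>x y. x mod 2 ^ k \<le> y mod 2 ^ k) cs'"
proof (induction k)
  case 0
  have "sorted_wrt (\<lambda>x y. True) cs" by (induction cs) auto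
  then show ?case using reach_refl by (intro exI[of _ cs]) auto
next
  case (Suc k)
  then obtain cs' where cs': "reach (2 * length cs * k) (stacks [] [] cs) (stacks [] [] cs')"
    "mset cs' = mset cs" "sorted_wrt (\<lambda>x y. x mod 2 ^ k \<le> y mod 2 ^ k) cs'" by blast
  define P where "P x \<longleftrightarrow> odd (x div 2 ^ k)" for x :: nat
  have md: "x mod 2 ^ Suc k = (if P x then 2 ^ k + x mod 2 ^ k else x mod 2 ^ k)" for x :: nat
    unfolding P_def power_Suc2 mod_mult2_eq by (auto simp: odd_iff_mod_2_eq_one even_iff_mod_2_eq_zero)
  let ?cs = "filter (\<lambda>x. \<not> P x) cs' @ filter P cs'"
  have "reach (2 * length cs' + 2 * length cs * k) (stacks [] [] cs) (stacks [] [] ?cs)"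
    using reach_trans[OF cs'(1) reach_partition[of cs' P]] by (simp add: add.commute)
  moreover have "length cs' = length cs" using cs'(2) by (metis size_mset)
  moreover have "mset ?cs = mset cs" using cs'(2) by (simp add: mset_filter)
  moreover have "sorted_wrt (\<lambda>x y. x mod 2 ^ Suc k \<le> y mod 2 ^ Suc k) ?cs"
    unfolding sorted_wrt_append
  proof (intro conjI ballI)
    \<comment> \<open>Bit \<open>k\<close> is constant on each part, and filtering keeps the order
      by the lower bits.\<close>
    have *: "sorted_wrt (\<lambda>x y. x mod 2 ^ k \<le> y mod 2 ^ k) (filter Q cs')" for Q
      using cs'(3) by (rule sorted_wrt_filter)
    show "sorted_wrt (\<lambda>x y. x mod 2 ^ Suc k \<le> y mod 2 ^ Suc k) (filter (\<lambda>x. \<not> P x) cs')"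
      by (rule sorted_wrt_mono_rel[OF _ *]) (simp add: md del: power_Suc)
    show "sorted_wrt (\<lambda>x y. x mod 2 ^ Suc k \<le> y mod 2 ^ Suc k) (filter P cs')"
      by (rule sorted_wrt_mono_rel[OF _ *]) (simp add: md del: power_Suc)
    fix x y assume "x \<in> set (filter (\<lambda>x. \<not> P x) cs')" "y \<in> set (filter P cs')"
    then show "x mod 2 ^ Suc k \<le> y mod 2 ^ Suc k"
      using mod_less_divisor[of "2 ^ k" x] by (simp add: md del: power_Suc mod_less_divisor)
  qed
  ultimately show ?case by (intro exI[of _ ?cs]) (auto simp: algebra_simps)
qed

lemma reach_sort:
  assumes "mset cs = mset [0..<n]" "n \<le> 2 ^ k"
  shows "reach (2 * n * k) (stacks [] [] cs) (stacks [] [] [0..<n])"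
proof -
  obtain cs' where cs': "reach (2 * length cs * k) (stacks [] [] cs) (stacks [] [] cs')"
    "mset cs' = mset cs" "sorted_wrt (\<lambda>x y. x mod 2 ^ k \<le> y mod 2 ^ k) cs'"
    using reach_radix by blast
  have "set cs' = {0..<n}" using cs'(2) assms(1) by (metis set_mset_mset set_upt)
  \<comment> \<open>All entries are below \<open>2 ^ k\<close>, so reduction modulo
    \<open>2 ^ k\<close> does not change them.\<close>
  then have "sorted cs'"
    by (intro sorted_wrt_mono_rel[OF _ cs'(3)]) (use assms(2) in auto)
  then have "sort [0..<n] = cs'"
    by (intro properties_for_sort) (simp_all only: cs'(2) assms(1))
  then have "cs' = [0..<n]" by (simp add: sort_key_id_if_sorted)
  moreover have "length cs = n" using assms(1) by (metis size_mset length_upt diff_zero)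
  ultimately show ?thesis using cs'(1) by simp
qed

end

text \<open>The trees are numbered by their positions in \<open>vs\<close>, so that
  \<open>us\<close> becomes a list of numbers to be sorted; equal trees at different positions get
  different numbers.\<close>

lemma reach_permute_stack:
  assumes "mset us = mset vs" "length us \<le> 2 ^ k"
  shows "reach (2 * length us * k) (Nd p (Nd q (stack us r))) (Nd p (Nd q (stack vs r)))"
proof -
  let ?n = "length vs"
  have n: "length us = ?n" using assms(1) by (metis size_mset)
  obtain f where f: "f permutes {..<?n}" "permute_list f vs = us"
    using mset_eq_permutation[OF assms(1)] by blast
  define cs where "cs = map f [0..<?n]"
  have us: "us = map ((!) vs) cs" using f(2) by (auto simp: cs_def permute_list_def)
  have vs: "vs = map ((!) vs) [0..<?n]" by (simp add: map_nth)
  have "mset cs = mset [0..<?n]"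
  proof -
    have "mset (map f [0..<?n]) = image_mset f (mset_set {..<?n})" by (simp add: atLeast0LessThan)
    also have "\<dots> = mset_set (f ` {..<?n})"
      by (rule image_mset_mset_set) (use f(1) permutes_inj_on in blast)
    also have "\<dots> = mset [0..<?n]" by (simp add: permutes_image[OF f(1)] atLeast0LessThan)
    finally show ?thesis by (simp add: cs_def)
  qed
  from reach_sort[OF this, of k "(!) vs" p q r] show ?thesis
    unfolding stacks_def us[symmetric] vs[symmetric] using assms(2) n by simp
qed

text \<open>
  One block is cut into three pieces that become the bottoms of the stacks; since only the cyclic
  order of the blocks matters up to linearly many steps, any block will do.
\<close>

lemma reach_permute_blocks:
  assumes "labels t = concat ws" "labels u = concat ws'" "mset ws = mset ws'"
    and "\<And>w. w \<in> set ws \<Longrightarrow> length w \<ge> 3" "length ws \<le> 2 ^ k"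
  shows "reach (34 * leaves t + 2 * length ws * k) t u"
proof -
  have "ws \<noteq> []" using assms(1) by (metis concat.simps(1) labels_nonempty)
  then obtain us z where ws: "ws = us @ [z]" by (metis rev_exhaust)
  then have "z \<in> set ws'" using assms(3) by (metis in_set_conv_decomp mset_eq_setD)
  then obtain v1 v2 where ws': "ws' = v1 @ z # v2" by (metis split_list)
  define lr lp lq where "lr = [hd z]" and "lp = [hd (tl z)]" and "lq = tl (tl z)"
  have "length z \<ge> 3" using assms(4) ws by simp
  then have z: "z = lr @ lp @ lq" "lr \<noteq> []" "lp \<noteq> []" "lq \<noteq> []"
    unfolding lr_def lp_def lq_def by (cases z; cases "tl z"; cases "tl (tl z)"; auto)+
  have ne: "w \<noteq> []" if "w \<in> set ws" for w using assms(4)[OF that] by auto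
  \<comment> \<open>The word of \<open>conf xs\<close> begins with \<open>lp @ lq\<close> and ends
    with \<open>lr\<close>; read cyclically it is \<open>concat xs\<close> followed by the uncut
    block \<open>z\<close>.\<close>
  define conf where "conf xs = Nd (vine lp) (Nd (vine lq) (stack (map vine xs) (vine lr)))" for xs
  have lab: "labels (conf xs) = lp @ lq @ concat xs @ lr" if "set xs \<subseteq> set ws" for xs
  proof -
    have "concat (map labels (map vine xs)) = concat xs"
      using that ne by (induction xs) (auto simp: labels_vine)
    then show ?thesis using z(2-4) by (simp add: conf_def labels_stack labels_vine)
  qed
  \<comment> \<open>Rotated so that \<open>z\<close> stands last, \<open>ws'\<close> becomes
    \<open>v2 @ v1 @ [z]\<close>; it remains to permute \<open>us\<close> into
    \<open>v2 @ v1\<close>.\<close>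
  have m: "mset us = mset (v2 @ v1)" using assms(3) ws ws' by simp
  then have su: "set us = set (v2 @ v1)" by (metis mset_eq_setD)
  have "reach (17 * leaves t) t (conf us)"
    by (rule reach_rotate[of _ "concat us @ lr" "lp @ lq"])
      (use ws assms(1) z(2-4) lab[of us] in \<open>auto simp: z(1)\<close>)
  moreover have "reach (2 * length us * k) (conf us) (conf (v2 @ v1))"
    unfolding conf_def using reach_permute_stack[of "map vine us" "map vine (v2 @ v1)" k] m assms(5) ws
    by simp
  moreover have "reach (17 * leaves u) (conf (v2 @ v1)) u"
    by (rule reach_sym, rule reach_rotate[of _ "concat v1 @ lr" "lp @ lq @ concat v2"])
      (use ws' ws su assms(2) z(2-4) lab[of "v2 @ v1"] in \<open>auto simp: z(1)\<close>)
  ultimately have "reach (17 * leaves t + (2 * length us * k + 17 * leaves u)) t u"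
    using reach_trans by blast
  moreover have "leaves u = leaves t"
  proof -
    have "length (concat xs) = \<Sum>\<^sub># (image_mset length (mset xs))" for xs :: "'a list list"
      by (induction xs) auto
    then show ?thesis using assms(1-3) by simp
  qed
  ultimately show ?thesis
    by (elim reach_mono) (simp add: ws algebra_simps)
qed

section \<open>Moves as elements of V\<close>

fun leaf_list :: "'a ltree \<Rightarrow> (bool list \<times> 'a) list" where
  "leaf_list (Lf a) = [([], a)]"
| "leaf_list (Nd l r) =
     map (apfst (Cons False)) (leaf_list l) @ map (apfst (Cons True)) (leaf_list r)"

fun shape :: "'a ltree \<Rightarrow> unit tree" where
  "shape (Lf a) = \<langle>\<rangle>"
| "shape (Nd l r) = \<langle>shape l, (), shape r\<rangle>"

lemma map_snd_leaf_list: "map snd (leaf_list t) = labels t"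
  by (induction t) (auto simp: comp_def)

lemma map_fst_leaf_list: "map fst (leaf_list t) = paths (shape t)"
proof (induction t)
  case (Nd l r)
  have "map fst (map (apfst (Cons b)) xs) = map (Cons b) (map fst xs)"
    for b and xs :: "(bool list \<times> 'a) list" by (induction xs) auto
  with Nd show ?case by (simp del: map_map)
qed auto

lemma set_labels: "a \<in> set (labels t) \<longleftrightarrow> (\<exists>p. (p, a) \<in> set (leaf_list t))"
  unfolding map_snd_leaf_list[symmetric] by force

lemma leaf_list_zip: "length ls = size1 T \<Longrightarrow> \<exists>t. leaf_list t = zip (paths T) ls"
proof (induction T arbitrary: ls)
  case Leaf
  then obtain a where "ls = [a]" by (cases ls) auto
  then show ?case by (intro exI[of _ "Lf a"]) simp
next
  case (Node l x r)
  obtain t where t: "leaf_list t = zip (paths l) (take (size1 l) ls)"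
    using Node.IH(1)[of "take (size1 l) ls"] Node.prems by auto
  obtain u where u: "leaf_list u = zip (paths r) (drop (size1 l) ls)"
    using Node.IH(2)[of "drop (size1 l) ls"] Node.prems by auto
  have ap: "map (apfst f) (zip xs ys) = zip (map f xs) ys" for f :: "'c \<Rightarrow> 'd" and xs and ys :: "'e list"
    by (simp add: zip_map1 apfst_def map_prod_def)
  have "zip (paths \<langle>l, x, r\<rangle>) ls =
      zip (paths \<langle>l, x, r\<rangle>) (take (size1 l) ls @ drop (size1 l) ls)" by simp
  also have "\<dots> = leaf_list (Nd t u)"
    using Node.prems unfolding paths.simps by (subst zip_append) (simp_all add: t u ap)
  finally show ?case by (intro exI[of _ "Nd t u"]) simp
qed

lemma leaf_list_cover:
  assumes "x \<in> {0..<1}"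
  obtains p a s where "(p, a) \<in> set (leaf_list t)" "s \<in> {0..<1}" "x = pt p s"
proof -
  obtain p s where p: "p \<in> set (paths (shape t))" "s \<in> {0..<1}" "x = pt p s"
    using paths_cover assms by blast
  then show thesis using that by (auto simp flip: map_fst_leaf_list)
qed

lemma leaf_list_path_unique:
  assumes "distinct (labels t)" "(p, a) \<in> set (leaf_list t)" "(q, a) \<in> set (leaf_list t)"
  shows "p = q"
proof -
  have "inj_on snd (set (leaf_list t))"
    using assms(1) unfolding map_snd_leaf_list[symmetric] distinct_map by blast
  from inj_onD[OF this, of "(p, a)" "(q, a)"] show ?thesis using assms by simp
qed

lemma leaf_list_disjoint:
  assumes "(p, a) \<in> set (leaf_list t)" "(q, b) \<in> set (leaf_list t)" "pt p s = pt q s'"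
    "s \<in> {0..<1}" "s' \<in> {0..<1}"
  shows "p = q" "a = b"
proof -
  have "p \<in> set (paths (shape t))" "q \<in> set (paths (shape t))"
    unfolding map_fst_leaf_list[symmetric] using assms(1,2) by force+
  then show pq: "p = q" using paths_disjoint assms(3-5) by blast
  have "inj_on fst (set (leaf_list t))"
    using distinct_paths[of "shape t"] unfolding map_fst_leaf_list[symmetric] distinct_map by blast
  from inj_onD[OF this, of "(p, a)" "(q, b)"] show "a = b" using assms(1,2) pq by simp
qed

definition carries :: "(real \<Rightarrow> real) \<Rightarrow> 'a ltree \<Rightarrow> 'a ltree \<Rightarrow> bool" where
  "carries f t u \<longleftrightarrow> (\<forall>(p, a)\<in>set (leaf_list t). \<exists>q. (q, a) \<in> set (leaf_list u) \<and> cmap f p q)"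

lemma carries_compose:
  "carries g t u \<Longrightarrow> carries f u v \<Longrightarrow> carries (compose {0..<1} f g) t v"
  unfolding carries_def using cmap_comp by fast

text \<open>Turns the fixed pattern of a move into its instances, and later splits every leaf of a
  diagram into three.\<close>

fun graft :: "('a \<Rightarrow> 'b ltree) \<Rightarrow> 'a ltree \<Rightarrow> 'b ltree" where
  "graft \<theta> (Lf a) = \<theta> a"
| "graft \<theta> (Nd l r) = Nd (graft \<theta> l) (graft \<theta> r)"

lemma labels_graft: "labels (graft \<theta> t) = concat (map (\<lambda>a. labels (\<theta> a)) (labels t))"
  by (induction t) auto

lemma leaf_list_graft:
  fixes \<theta> :: "'a \<Rightarrow> 'b ltree"
  shows "(p, b) \<in> set (leaf_list (graft \<theta> t)) \<longleftrightarrow>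
   (\<exists>q r a. p = q @ r \<and> (q, a) \<in> set (leaf_list t) \<and> (r, b) \<in> set (leaf_list (\<theta> a)))"
proof (induction t arbitrary: p)
  case (Nd l r)
  have *: "(p, c) \<in> apfst (Cons b) ` A \<longleftrightarrow> (\<exists>p'. p = b # p' \<and> (p', c) \<in> A)"
    for b p c and A :: "(bool list \<times> 'c) set"
    by force
  have **: "(\<exists>p'. p = c # p' \<and> (\<exists>q s a. p' = q @ s \<and> A q a \<and> B s a)) \<longleftrightarrow>
      (\<exists>q s a. p = q @ s \<and> (\<exists>q'. q = c # q' \<and> A q' a) \<and> B s a)"
    for c and A B :: "bool list \<Rightarrow> 'a \<Rightarrow> bool"
  proof
    assume "\<exists>p'. p = c # p' \<and> (\<exists>q s a. p' = q @ s \<and> A q a \<and> B s a)"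
    then obtain q s a where "p = (c # q) @ s" "A q a" "B s a" by auto
    then show "\<exists>q s a. p = q @ s \<and> (\<exists>q'. q = c # q' \<and> A q' a) \<and> B s a" by blast
  qed (auto, blast)
  have "(p, b) \<in> set (leaf_list (graft \<theta> (Nd l r))) \<longleftrightarrow>
      (\<exists>p'. p = False # p' \<and> (\<exists>q s a. p' = q @ s \<and>
        (q, a) \<in> set (leaf_list l) \<and> (s, b) \<in> set (leaf_list (\<theta> a)))) \<or>
      (\<exists>p'. p = True # p' \<and> (\<exists>q s a. p' = q @ s \<and>
        (q, a) \<in> set (leaf_list r) \<and> (s, b) \<in> set (leaf_list (\<theta> a))))"
    by (simp add: * Nd)
  also have "\<dots> \<longleftrightarrow> (\<exists>q s a. p = q @ s \<and>
      (q, a) \<in> set (leaf_list (Nd l r)) \<and> (s, b) \<in> set (leaf_list (\<theta> a)))"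
    by (simp only: ** leaf_list.simps set_append set_map Un_iff * conj_disj_distribL
        conj_disj_distribR ex_disj_distrib)
  finally show ?case .
qed auto

text \<open>A map that is affine on a leaf takes everything below the leaf along, so one element of
  V serves all instances of a move.\<close>

lemma carries_graft: "carries f t u \<Longrightarrow> carries f (graft \<theta> t) (graft \<theta> u)"
  unfolding carries_def
proof clarify
  fix p b assume t: "\<forall>(p, a)\<in>set (leaf_list t). \<exists>q. (q, a) \<in> set (leaf_list u) \<and> cmap f p q"
    and "(p, b) \<in> set (leaf_list (graft \<theta> t))"
  then obtain q r a where p: "p = q @ r" "(q, a) \<in> set (leaf_list t)" "(r, b) \<in> set (leaf_list (\<theta> a))"
    unfolding leaf_list_graft by blast
  then obtain q' where "(q', a) \<in> set (leaf_list u)" "cmap f q q'" using t by blast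
  then show "\<exists>q. (q, b) \<in> set (leaf_list (graft \<theta> u)) \<and> cmap f p q"
    unfolding leaf_list_graft p(1) using cmap_append p(3) by blast
qed

lemma carries_inverse:
  assumes "carries f t u" "f \<in> Bij {0..<1}" "distinct (labels u)" "set (labels t) = set (labels u)"
  shows "carries (\<lambda>x\<in>{0..<1}. inv_into {0..<1} f x) u t"
  unfolding carries_def
proof clarify
  fix q a assume q: "(q, a) \<in> set (leaf_list u)"
  then obtain p where p: "(p, a) \<in> set (leaf_list t)" using assms(4) set_labels by metis
  then obtain q' where "(q', a) \<in> set (leaf_list u)" "cmap f p q'"
    using assms(1) unfolding carries_def by blast
  then have "cmap f p q" using leaf_list_path_unique[OF assms(3) q] by blast
  then show "\<exists>p. (p, a) \<in> set (leaf_list t) \<and> cmap (\<lambda>x\<in>{0..<1}. inv_into {0..<1} f x) q p"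
    using p cmap_inverse[OF assms(2)] by blast
qed

text \<open>The affine maps between equally labelled leaves are glued together. The relation
  \<open>R\<close> between points is turned around by exchanging the trees, so the map glued in the
  other direction is the inverse.\<close>

lemma carries_exists:
  assumes "distinct (labels t)" "distinct (labels u)" "set (labels t) = set (labels u)"
  shows "\<exists>f\<in>carrier thompson_V. carries f t u"
proof -
  define R where "R t u x y \<longleftrightarrow> (\<exists>p q a s. (p, a) \<in> set (leaf_list t) \<and> (q, a) \<in> set (leaf_list u) \<and>
    s \<in> {0..<1} \<and> x = pt p s \<and> y = pt q s)" for t u :: "'a ltree" and x y
  define F where "F t u = (\<lambda>x\<in>{0..<1}. SOME y. R t u x y)" for t u
  have ex: "\<exists>y. R t u x y" if x: "x \<in> {0..<1}" and eq: "set (labels t) = set (labels u)" for t u x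
  proof -
    obtain p a s where p: "(p, a) \<in> set (leaf_list t)" "s \<in> {0..<1}" "x = pt p s"
      using leaf_list_cover[OF x] .
    then obtain q where "(q, a) \<in> set (leaf_list u)" using eq set_labels by metis
    then show ?thesis using p unfolding R_def by blast
  qed
  have uniq: "y = y'" if xy: "R t u x y" and xy': "R t u x y'" and dist: "distinct (labels u)" for t u x y y'
  proof -
    obtain p q a s where 1: "(p, a) \<in> set (leaf_list t)" "(q, a) \<in> set (leaf_list u)"
      "s \<in> {0..<1}" "x = pt p s" "y = pt q s" using xy unfolding R_def by blast
    obtain p' q' a' s' where 2: "(p', a') \<in> set (leaf_list t)" "(q', a') \<in> set (leaf_list u)"
      "s' \<in> {0..<1}" "x = pt p' s'" "y' = pt q' s'" using xy' unfolding R_def by blast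
    have e: "p = p'" "a = a'" using leaf_list_disjoint[of p a t p' a' s s'] 1 2 by auto
    then have "q = q'" using leaf_list_path_unique[OF dist] 1 2 by blast
    moreover have "s = s'" using e 1 2 pt_cancel by metis
    ultimately show ?thesis using 1 2 by simp
  qed
  have R: "R t u x (F t u x)" if "x \<in> {0..<1}" "set (labels t) = set (labels u)" for t u x
    unfolding F_def using someI_ex[OF ex[OF that]] that(1) by simp
  have Reqv: "R t u x y \<longleftrightarrow> R u t y x" for t u x y unfolding R_def by blast
  have Rin: "x \<in> {0..<1}" "y \<in> {0..<1}" if "R t u x y" for t u x y
    using that pt_in_unit unfolding R_def by blast+
  have inv: "F u t (F t u x) = x" if "x \<in> {0..<1}" "set (labels t) = set (labels u)" "distinct (labels t)"
    for t u x
  proof -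
    have 1: "R u t (F t u x) x" using R[OF that(1,2)] Reqv by blast
    have "R u t (F t u x) (F u t (F t u x))" using R[of "F t u x" u t] Rin[OF 1] that(2) by simp
    from uniq[OF this 1 that(3)] show ?thesis .
  qed
  have "bij_betw (F t u) {0..<1} {0..<1}"
  proof (rule bij_betw_byWitness[where f' = "F u t"])
    show "\<forall>x\<in>{0..<1}. F u t (F t u x) = x" using inv[OF _ assms(3,1)] by blast
    show "\<forall>x\<in>{0..<1}. F t u (F u t x) = x" using inv[OF _ assms(3)[symmetric] assms(2)] by blast
    show "F t u ` {0..<1} \<subseteq> {0..<1}" using Rin(2)[OF R[OF _ assms(3)]] by blast
    show "F u t ` {0..<1} \<subseteq> {0..<1}" using Rin(2)[OF R[OF _ assms(3)[symmetric]]] by blast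
  qed
  then have B: "F t u \<in> Bij {0..<1}" unfolding Bij_def F_def by auto
  have c: "carries (F t u) t u"
    unfolding carries_def
  proof clarify
    fix p a assume p: "(p, a) \<in> set (leaf_list t)"
    then obtain q where q: "(q, a) \<in> set (leaf_list u)" using assms(3) set_labels by metis
    have "F t u (pt p s) = pt q s" if "s \<in> {0..<1}" for s
    proof -
      have "R t u (pt p s) (pt q s)" using p q that unfolding R_def by blast
      then show ?thesis using uniq[OF R _ assms(2)] Rin assms(3) by blast
    qed
    then show "\<exists>q. (q, a) \<in> set (leaf_list u) \<and> cmap (F t u) p q" using q unfolding cmap_def by blast
  qed
  have "bad (F t u) \<subseteq> ints (shape t)"
  proof
    fix x assume x: "x \<in> bad (F t u)"
    show "x \<in> ints (shape t)"
    proof (rule ccontr)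
      assume "x \<notin> ints (shape t)"
      then obtain p r where p: "p \<in> set (paths (shape t))" "x = p @ r" using ints_or_below_leaf by blast
      then obtain a where "(p, a) \<in> set (leaf_list t)" unfolding map_fst_leaf_list[symmetric] by auto
      then have "p \<notin> bad (F t u)" using c unfolding carries_def bad_def by blast
      then show False using x p bad_prefix by blast
    qed
  qed
  then have "F t u \<in> carrier thompson_V"
    unfolding V_iff_finite_bad using B finite_ints finite_subset by blast
  with c show ?thesis by blast
qed

lemma carries_self:
  assumes "f \<in> carrier thompson_V" "carries f t t" "distinct (labels t)"
  shows "f = \<one>\<^bsub>thompson_V\<^esub>"
proof -
  have "f x = x" if x: "x \<in> {0..<1}" for x
  proof -
    obtain p a s where p: "(p, a) \<in> set (leaf_list t)" "s \<in> {0..<1}" "x = pt p s"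
      using leaf_list_cover[OF x] .
    then obtain q where "(q, a) \<in> set (leaf_list t)" "cmap f p q" using assms(2) unfolding carries_def by blast
    then have "cmap f p p" using leaf_list_path_unique[OF assms(3) p(1)] by blast
    then show ?thesis using p unfolding cmap_def by blast
  qed
  moreover have "f \<in> extensional {0..<1}" using assms(1) unfolding V_iff_finite_bad Bij_def by blast
  ultimately show ?thesis unfolding V_one by (auto intro: extensionalityI[of _ "{0..<1}"])
qed

section \<open>From sequences of moves to words in the generators\<close>

lemma V_inv:
  assumes "f \<in> carrier thompson_V"
  shows "inv\<^bsub>thompson_V\<^esub> f = (\<lambda>x\<in>{0..<1}. inv_into {0..<1} f x)"
proof -
  have "f \<in> Bij {0..<1}" using assms V_iff_finite_bad by blast
  then show ?thesis
    using group.m_inv_consistent[OF group_BijGroup V_subgroup assms] inv_BijGroup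
    by (simp add: thompson_V_def)
qed

text \<open>The basic moves with numbered leaves in place of subtrees; inverse moves are obtained
  from the converse relation.\<close>

definition patterns :: "(nat ltree \<times> nat ltree) set" where
  "patterns =
    {(Nd (Nd (Lf 0) (Lf 1)) (Lf 2), Nd (Lf 0) (Nd (Lf 1) (Lf 2))),
     (Nd (Lf 0) (Nd (Nd (Lf 1) (Lf 2)) (Lf 3)), Nd (Lf 0) (Nd (Lf 1) (Nd (Lf 2) (Lf 3)))),
     (Nd (Lf 0) (Lf 1), Nd (Lf 1) (Lf 0)),
     (Nd (Lf 0) (Nd (Lf 1) (Nd (Lf 2) (Lf 3))), Nd (Nd (Lf 2) (Lf 0)) (Nd (Lf 1) (Lf 3))),
     (Nd (Lf 0) (Nd (Lf 1) (Nd (Lf 2) (Lf 3))), Nd (Lf 0) (Nd (Nd (Lf 2) (Lf 1)) (Lf 3)))}"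

lemma step_pattern:
  assumes "step t u"
  obtains P Q \<theta> where "(P, Q) \<in> patterns \<union> patterns\<inverse>" "t = graft \<theta> P" "u = graft \<theta> Q"
proof -
  have "\<exists>P Q \<theta>. (P, Q) \<in> patterns \<union> patterns\<inverse> \<and> t = graft \<theta> P \<and> u = graft \<theta> Q"
    using assms
  proof induction
    case (rot a b c)
    \<comment> \<open>The substitution looks up leaf number \<open>i\<close> in the list of
      subtrees, and the insertion rules select the pattern of this move. The other moves are
      alike.\<close>
    show ?case by (rule exI, rule exI, rule exI[of _ "(!) [a, b, c]"], intro conjI UnI1,
      unfold patterns_def, rule insertI1) auto
  next
    case (rot' a b c d)
    show ?case by (rule exI, rule exI, rule exI[of _ "(!) [a, b, c, d]"], intro conjI UnI1,
      unfold patterns_def, rule insertI2, rule insertI1) auto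
  next
    case (swap a b)
    show ?case by (rule exI, rule exI, rule exI[of _ "(!) [a, b]"], intro conjI UnI1,
      unfold patterns_def, rule insertI2, rule insertI2, rule insertI1) auto
  next
    case (move1 a b x c)
    show ?case by (rule exI, rule exI, rule exI[of _ "(!) [a, b, x, c]"], intro conjI UnI1,
      unfold patterns_def, rule insertI2, rule insertI2, rule insertI2, rule insertI1) auto
  next
    case (move2 a b x c)
    show ?case by (rule exI, rule exI, rule exI[of _ "(!) [a, b, x, c]"], intro conjI UnI1,
      unfold patterns_def, rule insertI2, rule insertI2, rule insertI2, rule insertI2, rule insertI1) auto
  next
    case (inverse t u)
    then show ?case by blast
  qed
  then show thesis using that by blast
qed

text \<open>If \<open>?g\<close> effects the first move, from \<open>t\<close> to \<open>v\<close>,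
  then \<open>x\<close> after the inverse of \<open>?g\<close> carries \<open>v\<close> to
  \<open>u\<close> along the remaining moves. As \<open>?g\<close> comes from a finite set, each
  move adds at most \<open>M\<close> to the word length.\<close>

lemma word_length_le_reach:
  assumes "finite S" "S \<subseteq> carrier thompson_V" "generate thompson_V S = carrier thompson_V"
  shows "\<exists>M. \<forall>x\<in>carrier thompson_V. \<forall>k. \<forall>t u :: 'a ltree.
    distinct (labels u) \<and> reach k t u \<and> carries x t u \<longrightarrow> word_length thompson_V S x \<le> M * k"
proof -
  interpret V: group thompson_V by (rule group_V)
  let ?A = "patterns \<union> patterns\<inverse>"
  have fin: "finite ?A" unfolding patterns_def by simp
  have dist: "distinct (labels P) \<and> distinct (labels Q) \<and> set (labels P) = set (labels Q)"
    if "(P, Q) \<in> ?A" for P Q using that unfolding patterns_def by auto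
  have "\<exists>f\<in>carrier thompson_V. carries f (fst PQ) (snd PQ)" if "PQ \<in> ?A" for PQ
    by (rule carries_exists) (use dist[of "fst PQ" "snd PQ"] that in \<open>simp_all only: prod.collapse\<close>)
  then obtain E where E: "E PQ \<in> carrier thompson_V \<and> carries (E PQ) (fst PQ) (snd PQ)"
    if "PQ \<in> ?A" for PQ by metis
  define M where "M = (\<Sum>PQ\<in>?A. word_length thompson_V S (E PQ))"
  have M: "word_length thompson_V S (E PQ) \<le> M" if "PQ \<in> ?A" for PQ
    unfolding M_def using that fin by (intro member_le_sum) auto
  have main: "word_length thompson_V S x \<le> M * j"
    if "(step ^^ j) t u" "x \<in> carrier thompson_V" "carries x t u" "distinct (labels u)"
    for j x and t u :: "'a ltree"
    using that
  proof (induction j arbitrary: t x)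
    case 0
    then have "x = \<one>\<^bsub>thompson_V\<^esub>" using carries_self[of x u] by simp
    then show ?case by (simp add: V.word_length_one)
  next
    case (Suc j)
    obtain v where v: "step t v" "(step ^^ j) v u" using Suc.prems(1) by (metis relpowp_Suc_D2)
    obtain P Q \<theta> where PQ: "(P, Q) \<in> ?A" "t = graft \<theta> P" "v = graft \<theta> Q"
      using step_pattern[OF v(1)] by metis
    let ?g = "E (P, Q)"
    have g: "?g \<in> carrier thompson_V" "carries ?g P Q" using E[OF PQ(1)] by auto
    have gB: "?g \<in> Bij {0..<1}" and xB: "x \<in> Bij {0..<1}"
      using g(1) Suc.prems(2) V_iff_finite_bad by blast+
    have "carries (inv\<^bsub>thompson_V\<^esub> ?g) Q P"
      unfolding V_inv[OF g(1)] using carries_inverse[OF g(2) gB] dist[OF PQ(1)] by blast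
    then have c: "carries (inv\<^bsub>thompson_V\<^esub> ?g) v t" unfolding PQ by (rule carries_graft)
    let ?y = "x \<otimes>\<^bsub>thompson_V\<^esub> inv\<^bsub>thompson_V\<^esub> ?g"
    have "inv\<^bsub>thompson_V\<^esub> ?g \<in> Bij {0..<1}" using V.inv_closed[OF g(1)] V_iff_finite_bad by blast
    then have "carries ?y v u" using carries_compose[OF c Suc.prems(3)] V_mult[OF xB] by simp
    moreover have y: "?y \<in> carrier thompson_V" using g Suc.prems by simp
    ultimately have "word_length thompson_V S ?y \<le> M * j" using Suc.IH v(2) Suc.prems(4) by blast
    moreover have "x = ?y \<otimes>\<^bsub>thompson_V\<^esub> ?g" using g Suc.prems by (simp add: V.m_assoc)
    ultimately have "word_length thompson_V S x \<le> M * j + M"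
      using V.word_length_mult[OF assms(2,3) y g(1)] M[OF PQ(1)] by simp
    then show ?case by simp
  qed
  have "word_length thompson_V S x \<le> M * k"
    if r: "distinct (labels u) \<and> reach k t u \<and> carries x t u" and x: "x \<in> carrier thompson_V"
    for x k and t u :: "'a ltree"
  proof -
    obtain j where j: "j \<le> k" "(step ^^ j) t u" using r unfolding reach_def by blast
    have "word_length thompson_V S x \<le> M * j" using main[OF j(2) x] r by simp
    also have "\<dots> \<le> M * k" using j(1) by simp
    finally show ?thesis .
  qed
  then show ?thesis by (intro exI[of _ M]) simp
qed

section \<open>Clusters\<close>

definition run :: "nat list \<Rightarrow> bool" where
  "run b \<longleftrightarrow> (\<exists>h l. b = [h..<h + l] \<and> l > 0)"

lemma run_nonempty: "run b \<Longrightarrow> b \<noteq> []"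
  unfolding run_def by auto

lemma run_snoc: "run b \<Longrightarrow> run (b @ [Suc (last b)])"
proof -
  assume "run b"
  then obtain h l where "b = [h..<h + l]" "l > 0" unfolding run_def by blast
  then have "b @ [Suc (last b)] = [h..<h + Suc l]" by (cases l) auto
  then show "run (b @ [Suc (last b)])" unfolding run_def by blast
qed

text \<open>Read from the left, each value of \<open>\<sigma>\<close> either continues the last
  block or opens a new one at a break; position 1 counts as a break to account for the first
  block.\<close>

lemma blocks_exist:
  fixes \<sigma> :: "nat \<Rightarrow> nat"
  shows "\<exists>bs. concat bs = map \<sigma> [1..<m + 1] \<and> (\<forall>b\<in>set bs. run b) \<and>
    length bs = card {i \<in> {1..m}. i = 1 \<or> \<sigma> i \<noteq> \<sigma> (i - 1) + 1}"
proof (induction m)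
  case (Suc m)
  let ?X = "\<lambda>m. {i \<in> {1..m}. i = 1 \<or> \<sigma> i \<noteq> \<sigma> (i - 1) + 1}"
  obtain bs where bs: "concat bs = map \<sigma> [1..<m + 1]" "\<forall>b\<in>set bs. run b" "length bs = card (?X m)"
    using Suc by blast
  show ?case
  proof (cases "m = 0 \<or> \<sigma> (Suc m) \<noteq> \<sigma> m + 1")
    case True
    then have "?X (Suc m) = insert (Suc m) (?X m)" by (auto simp: le_Suc_eq)
    then have "card (?X (Suc m)) = Suc (card (?X m))" by simp
    moreover have "run [\<sigma> (Suc m)]" unfolding run_def by (intro exI[of _ "\<sigma> (Suc m)"] exI[of _ 1]) auto
    ultimately show ?thesis using bs by (intro exI[of _ "bs @ [[\<sigma> (Suc m)]]"]) auto
  next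
    case False
    then have X: "?X (Suc m) = ?X m" by (auto simp: le_Suc_eq)
    have "bs \<noteq> []" using bs(1) False by auto
    then obtain bs0 b where b: "bs = bs0 @ [b]" by (metis rev_exhaust)
    have "b \<noteq> []" using bs(2) b run_nonempty by simp
    then have "last b = last (concat bs)" using b by simp
    also have "\<dots> = \<sigma> m" using bs(1) False by (cases m) auto
    finally have "run (b @ [\<sigma> (Suc m)])" using run_snoc[of b] bs(2) b False by simp
    then show ?thesis using X bs b by (intro exI[of _ "bs0 @ [b @ [\<sigma> (Suc m)]]"]) auto
  qed
qed auto

text \<open>A cluster starts at every break, so the minima of the clusters include all
  breaks.\<close>

lemma card_breaks_le_clusters:
  "card {i \<in> {1..n}. i = 1 \<or> \<sigma> i \<noteq> \<sigma> (i - 1) + 1} \<le> card (clusters n \<sigma>)"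
proof -
  let ?X = "{i \<in> {1..n}. i = 1 \<or> \<sigma> i \<noteq> \<sigma> (i - 1) + 1}"
  have "\<exists>A\<in>clusters n \<sigma>. Min A = i" if i: "i \<in> ?X" for i
  proof -
    \<comment> \<open>The greatest such \<open>k\<close> gives a run from \<open>i\<close> that
      cannot be extended to the right; the break at \<open>i\<close> prevents an extension to the
      left.\<close>
    define Q where "Q k \<longleftrightarrow> i + k \<le> n \<and> (\<forall>j\<le>k. \<sigma> (i + j) = \<sigma> i + j)" for k
    have "Q 0" using i by (auto simp: Q_def)
    moreover have bound: "Q k \<Longrightarrow> k \<le> n" for k by (auto simp: Q_def)
    ultimately have max: "Q (Greatest Q)" "Q k \<Longrightarrow> k \<le> Greatest Q" for k
      by (blast intro: GreatestI_nat Greatest_le_nat)+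
    define k where "k = Greatest Q"
    have "Q k" using max(1) by (simp only: k_def)
    then have "i + k \<le> n" "\<forall>j\<le>k. \<sigma> (i + j) = \<sigma> i + j" unfolding Q_def by blast+
    moreover from this i have "{i..i + k} \<subseteq> {1..n}" by auto
    ultimately have r: "is_run n \<sigma> {i..i + k}" unfolding is_run_def by blast
    have "A' = {i..i + k}" if A': "is_run n \<sigma> A'" "{i..i + k} \<subseteq> A'" for A'
    proof -
      obtain h l where h: "A' = {h..h + l}" "A' \<subseteq> {1..n}" "\<forall>j\<le>l. \<sigma> (h + j) = \<sigma> h + j"
        using A'(1) unfolding is_run_def by blast
      have sub: "h \<le> i" "i + k \<le> h + l" using A'(2) h(1) by auto
      have "1 \<le> h" "h + l \<le> n" using h(1,2) by auto
      have "h = i"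
      proof (rule ccontr)
        assume "h \<noteq> i"
        then have "h < i" using sub by simp
        have "\<sigma> i = \<sigma> h + (i - h)" using h(3)[rule_format, of "i - h"] sub \<open>h < i\<close> by simp
        moreover have "\<sigma> (i - 1) = \<sigma> h + (i - 1 - h)"
          using h(3)[rule_format, of "i - 1 - h"] sub \<open>h < i\<close> by simp
        ultimately have "\<sigma> i = \<sigma> (i - 1) + 1" using \<open>h < i\<close> by simp
        then show False using i \<open>h < i\<close> \<open>1 \<le> h\<close> by auto
      qed
      moreover have "l = k"
      proof -
        have "Q l" using h(3) \<open>h + l \<le> n\<close> \<open>h = i\<close> by (auto simp: Q_def)
        then show ?thesis using max(2) sub \<open>h = i\<close> by (simp add: k_def le_antisym)
      qed
      ultimately show ?thesis using h by simp
    qed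
    then have "{i..i + k} \<in> clusters n \<sigma>" using r unfolding clusters_def by blast
    then show ?thesis by (intro bexI[of _ "{i..i + k}"]) (auto intro: Min_eqI)
  qed
  then have "?X \<subseteq> Min ` clusters n \<sigma>" by (metis (no_types, lifting) image_eqI subsetI)
  moreover have "finite (clusters n \<sigma>)"
    by (rule finite_subset[of _ "Pow {1..n}"]) (auto simp: clusters_def is_run_def)
  ultimately have "card ?X \<le> card (Min ` clusters n \<sigma>)"
    "card (Min ` clusters n \<sigma>) \<le> card (clusters n \<sigma>)"
    by (auto intro!: card_mono card_image_le)
  then show ?thesis by linarith
qed

text \<open>The head of a later run is at least that of an earlier one and, by distinctness, not
  inside it, so it lies beyond its end.\<close>

lemma sorted_concat_runs:
  assumes "\<forall>b\<in>set bs. run b" "distinct (concat bs)" "sorted (map hd bs)"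
  shows "sorted (concat bs)"
  using assms
proof (induction bs)
  case (Cons b bs)
  obtain h l where b: "b = [h..<h + l]" "l > 0" using Cons.prems(1) unfolding run_def by auto
  have "x \<le> y" if x: "x \<in> set b" and c_in: "c \<in> set bs" and y: "y \<in> set c" for x y c
  proof -
    obtain h' l' where c: "c = [h'..<h' + l']" "l' > 0"
      using Cons.prems(1) c_in unfolding run_def by auto
    have "hd b \<le> hd c" using Cons.prems(3) c_in by auto
    then have "h \<le> h'" using b c by simp
    moreover have "h' \<in> set c" using c by simp
    then have "h' \<notin> set b" using Cons.prems(2) c_in by auto
    ultimately have "h + l \<le> h'" using b by simp
    then show "x \<le> y" using x y b c by auto
  qed
  then show ?case using Cons b by (auto simp: sorted_append)
qed auto

text \<open>The leaves of the second tree will be labelled in increasing order, so this presents its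
  word as a rearrangement of the blocks of the first.\<close>

lemma sort_runs:
  assumes "\<forall>b\<in>set bs. run b" "mset (concat bs) = mset [1..<n + 1]"
  shows "concat (sort_key hd bs) = [1..<n + 1]"
proof -
  have "mset (concat xs) = mset (concat ys)" if "mset xs = mset ys" for xs ys :: "nat list list"
  proof -
    have "mset (concat zs) = \<Sum>\<^sub># (image_mset mset (mset zs))" for zs :: "nat list list"
      by (induction zs) auto
    then show ?thesis using that by simp
  qed
  then have m: "mset (concat (sort_key hd bs)) = mset [1..<n + 1]" using assms(2) by (metis mset_sort)
  then have "distinct (concat (sort_key hd bs))" using mset_eq_imp_distinct_iff[OF m] distinct_upt by blast
  then have "sorted (concat (sort_key hd bs))"
    using assms(1) by (intro sorted_concat_runs) auto
  then have "sort [1..<n + 1] = concat (sort_key hd bs)"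
    by (rule properties_for_sort[OF m])
  then show ?thesis using sort_key_id_if_sorted[of id "[1..<n + 1]"] by (simp add: id_def del: upt_Suc)
qed

text \<open>Rounding up the binary logarithm at most doubles it once \<open>b \<ge> 2\<close>; for
  \<open>b = 1\<close> the choice is \<open>k = 0\<close>.\<close>

lemma exists_power_two_ge:
  assumes "b \<ge> 1"
  obtains k where "b \<le> 2 ^ k" "real k \<le> 2 * log 2 (real b)"
proof (cases "b = 1")
  case True
  then show thesis using that[of 0] by simp
next
  case False
  then have b: "b \<ge> 2" using assms by simp
  define k where "k = nat \<lceil>log 2 (real b)\<rceil>"
  have l1: "log 2 (real b) \<ge> 1" using b by (subst le_log_iff) auto
  have "real b = 2 powr (log 2 (real b))" using b by simp
  also have "\<dots> \<le> 2 powr (real k)" using l1 by (intro powr_mono) (auto simp: k_def)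
  also have "\<dots> = 2 ^ k" by (simp add: powr_realpow)
  finally have 1: "b \<le> 2 ^ k" using of_nat_le_iff[of b "2 ^ k", where 'a = real] by simp
  have "real k \<le> log 2 (real b) + 1" unfolding k_def using l1 by linarith
  also have "\<dots> \<le> 2 * log 2 (real b)" using l1 by simp
  finally show thesis using that 1 by blast
qed

section \<open>The word metric\<close>

text \<open>Each leaf is split into three, so that every block can be cut into three bottoms of stacks.\<close>

lemma reach_reduced_diagram:
  fixes x :: "real \<Rightarrow> real"
  assumes "x \<in> carrier thompson_V"
  obtains t u :: "(nat \<times> nat) ltree" and b k :: nat
  where "carries x t u" "distinct (labels u)" "reach (102 * (num_carets x + 1) + 2 * b * k) t u"
    "1 \<le> b" "b \<le> num_clusters x" "real k \<le> 2 * log 2 (real b)"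
proof -
  note upt_Suc [simp del]
  obtain T1 \<sigma> T2 where D: "reduced_diagram x = (T1, \<sigma>, T2)" "is_diagram (T1, \<sigma>, T2)"
    "represents (T1, \<sigma>, T2) x" "ints T1 = bad x" using reduced_diagram_cases[OF assms] by metis
  let ?n = "size1 T1"
  have n: "?n = num_carets x + 1" using D(1) by (simp add: num_carets_def size1_size)
  have perm: "\<sigma> permutes {1..?n}" and n2: "size1 T2 = ?n" using D(2) unfolding is_diagram_def by auto
  \<comment> \<open>Leaf \<open>i\<close> of \<open>T1\<close> gets the label
    \<open>\<sigma> i\<close> and leaf \<open>j\<close> of \<open>T2\<close> the label
    \<open>j\<close>, so \<open>x\<close> sends each leaf to the one with the same label.\<close>
  obtain t0 where t0: "leaf_list t0 = zip (paths T1) (map \<sigma> [1..<?n + 1])"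
    using leaf_list_zip[of "map \<sigma> [1..<?n + 1]" T1] by auto
  obtain u0 where u0: "leaf_list u0 = zip (paths T2) [1..<?n + 1]"
    using leaf_list_zip[of "[1..<?n + 1]" T2] n2 by auto
  have lt0: "labels t0 = map \<sigma> [1..<?n + 1]" and lu0: "labels u0 = [1..<?n + 1]"
    using n2 by (simp_all flip: map_snd_leaf_list add: t0 u0)
  have c0: "carries x t0 u0"
    unfolding carries_def
  proof clarify
    fix p a assume "(p, a) \<in> set (leaf_list t0)"
    then obtain j where j: "j < ?n" "p = paths T1 ! j" "a = \<sigma> (Suc j)"
      unfolding t0 by (auto simp: in_set_zip)
    have rng: "1 \<le> a" "a \<le> ?n" using permutes_range[OF perm, of "Suc j"] j by auto
    have "(paths T2 ! (a - 1), a) \<in> set (leaf_list u0)"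
      unfolding u0 in_set_zip by (intro exI[of _ "a - 1"]) (use rng n2 in auto)
    moreover have "cmap x p (paths T2 ! (a - 1))"
      using D(3)[unfolded represents_iff[OF D(2)], rule_format, of "Suc j"] j by simp
    ultimately show "\<exists>q. (q, a) \<in> set (leaf_list u0) \<and> cmap x p q" by blast
  qed
  obtain bs where bs: "concat bs = map \<sigma> [1..<?n + 1]" "\<forall>b\<in>set bs. run b"
    "length bs = card {i \<in> {1..?n}. i = 1 \<or> \<sigma> i \<noteq> \<sigma> (i - 1) + 1}"
    using blocks_exist by blast
  have len: "length bs \<le> num_clusters x"
    using card_breaks_le_clusters[of ?n \<sigma>] bs(3) D(1) by (simp add: num_clusters_def)
  have "bs \<noteq> []" using bs(1) by (metis concat.simps(1) labels_nonempty lt0)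
  then have len1: "1 \<le> length bs" by (cases bs) auto
  have "mset (map \<sigma> [1..<?n + 1]) = mset [1..<?n + 1]"
  proof -
    have "mset (map \<sigma> [1..<?n + 1]) = image_mset \<sigma> (mset_set {1..?n})"
      by (simp add: atLeastLessThanSuc_atLeastAtMost)
    also have "\<dots> = mset_set (\<sigma> ` {1..?n})"
      by (rule image_mset_mset_set) (rule permutes_inj_on[OF perm])
    also have "\<dots> = mset [1..<?n + 1]"
      by (simp only: permutes_image[OF perm]) (simp add: atLeastLessThanSuc_atLeastAtMost)
    finally show ?thesis .
  qed
  then have sorted: "concat (sort_key hd bs) = [1..<?n + 1]" using sort_runs[OF bs(2)] bs(1) by simp
  define \<theta> :: "nat \<Rightarrow> (nat \<times> nat) ltree"
    where "\<theta> a = Nd (Lf (a, 0)) (Nd (Lf (a, 1)) (Lf (a, 2)))" for a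
  define w where "w b = concat (map (\<lambda>a. labels (\<theta> a)) b)" for b
  define t u where "t = graft \<theta> t0" and "u = graft \<theta> u0"
  have cc: "concat (map w cs) = concat (map (\<lambda>a. labels (\<theta> a)) (concat cs))" for cs
    by (induction cs) (auto simp: w_def)
  have lt: "labels t = concat (map w bs)" and lu: "labels u = concat (map w (sort_key hd bs))"
    unfolding t_def u_def labels_graft cc bs(1) sorted lt0 lu0 by simp_all
  obtain k where k: "length bs \<le> 2 ^ k" "real k \<le> 2 * log 2 (real (length bs))"
    using exists_power_two_ge[OF len1] .
  have w3: "length (w b) = 3 * length b" for b by (induction b) (auto simp: w_def \<theta>_def)
  have "reach (34 * leaves t + 2 * length (map w bs) * k) t u"
  proof (rule reach_permute_blocks[OF lt lu])
    show "mset (map w bs) = mset (map w (sort_key hd bs))" by simp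
    fix v assume "v \<in> set (map w bs)"
    then obtain b where "v = w b" "b \<noteq> []" using bs(2) run_nonempty by auto
    then show "3 \<le> length v" using w3[of b] by (cases b) auto
  next
    show "length (map w bs) \<le> 2 ^ k" using k(1) by simp
  qed
  moreover have "leaves t = 3 * ?n"
  proof -
    have "labels t = w (labels t0)" by (simp add: t_def labels_graft w_def)
    then show ?thesis by (simp add: w3 lt0)
  qed
  \<comment> \<open>Here \<open>102 = 34 * 3\<close>, since each of the
    \<open>num_carets x + 1\<close> leaves was split into three.\<close>
  ultimately have "reach (102 * (num_carets x + 1) + 2 * length bs * k) t u" by (simp add: n)
  moreover have "carries x t u" unfolding t_def u_def by (rule carries_graft[OF c0])
  moreover have "distinct (labels u)"
  proof -
    have "distinct (concat (map (\<lambda>a. labels (\<theta> a)) ls))" if "distinct ls" for ls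
      using that by (induction ls) (auto simp: \<theta>_def)
    then show ?thesis by (simp add: u_def labels_graft lu0)
  qed
  ultimately show thesis using that len1 len k(2) by blast
qed

text \<open>The number of moves is bounded by means of \<open>num_carets x + 1\<close>, which can be
  absorbed into a multiple of \<open>num_carets x\<close> only if the latter is positive; this
  settles the remaining case.\<close>

lemma num_carets_eq_0:
  assumes "x \<in> carrier thompson_V" "num_carets x = 0"
  shows "x = \<one>\<^bsub>thompson_V\<^esub>"
proof -
  obtain T1 \<sigma> T2 where D: "reduced_diagram x = (T1, \<sigma>, T2)" "is_diagram (T1, \<sigma>, T2)"
    "represents (T1, \<sigma>, T2) x" "ints T1 = bad x" using reduced_diagram_cases[OF assms(1)] by metis
  have "size T1 = 0" using assms(2) D(1) by (simp add: num_carets_def)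
  then have T: "T1 = \<langle>\<rangle>" "T2 = \<langle>\<rangle>" using D(2) by (auto simp: is_diagram_def size1_size)
  then have "\<sigma> 1 = 1" using D(2) permutes_range[of \<sigma> 1 1] by (auto simp: is_diagram_def)
  then have "cmap x [] []" using D(3)[unfolded represents_iff[OF D(2)]] T by simp
  then have "carries x (Lf ()) (Lf ())" by (simp add: carries_def)
  then show ?thesis using carries_self[OF assms(1), of "Lf ()"] by simp
qed

theorem theorem1p2:
  fixes S :: "(real \<Rightarrow> real) set"
  assumes "finite S"
    and "S \<subseteq> carrier thompson_V"
    and "generate thompson_V S = carrier thompson_V"
  shows "\<exists>K::real. K > 0 \<and> (\<forall>x\<in>carrier thompson_V.
           real (num_carets x) / K \<le> real (word_length thompson_V S x) \<and>
           real (word_length thompson_V S x) \<le>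
             K * (real (num_carets x) + real (num_clusters x) * ln (real (num_clusters x))))"
proof -
  obtain C where C: "num_carets x \<le> C * word_length thompson_V S x" if "x \<in> carrier thompson_V" for x
    using num_carets_le_word_length[OF assms] by blast
  obtain M where M: "\<forall>x\<in>carrier thompson_V. \<forall>k. \<forall>t u :: (nat \<times> nat) ltree.
      distinct (labels u) \<and> reach k t u \<and> carries x t u \<longrightarrow> word_length thompson_V S x \<le> M * k"
    using word_length_le_reach[OF assms, where 'a = "nat \<times> nat"] by blast
  \<comment> \<open>\<open>C\<close> serves the lower bound; \<open>204 = 2 * 102\<close> comes from
    \<open>N + 1 \<le> 2 * N\<close>, and \<open>4 / ln 2\<close> from \<open>2 * b * k\<close> with
    \<open>k\<close> at most twice the binary logarithm of \<open>b\<close>. The final 1 makes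
    \<open>K\<close> positive.\<close>
  define K where "K = real C + real M * (204 + 4 / ln 2) + 1"
  have M0: "real M * (204 + 4 / ln 2) \<ge> 0" by simp
  have "K > 0" using M0 unfolding K_def by linarith
  moreover have "real (num_carets x) / K \<le> real (word_length thompson_V S x)"
    if x: "x \<in> carrier thompson_V" for x
  proof -
    have "real (num_carets x) \<le> real C * real (word_length thompson_V S x)"
      using C[OF x] by (simp flip: of_nat_mult)
    also have "\<dots> \<le> K * real (word_length thompson_V S x)"
      by (rule mult_right_mono) (use M0 in \<open>auto simp: K_def\<close>)
    finally show ?thesis using \<open>K > 0\<close> by (simp add: field_simps)
  qed
  moreover have "real (word_length thompson_V S x) \<le>
      K * (real (num_carets x) + real (num_clusters x) * ln (real (num_clusters x)))"
    if x: "x \<in> carrier thompson_V" for x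
  proof -
    let ?N = "num_carets x" and ?B = "num_clusters x"
    obtain t u :: "(nat \<times> nat) ltree" and b k where r: "carries x t u" "distinct (labels u)"
      "reach (102 * (?N + 1) + 2 * b * k) t u" "1 \<le> b" "b \<le> ?B" "real k \<le> 2 * log 2 (real b)"
      using reach_reduced_diagram[OF x] .
    \<comment> \<open>From 1 on, \<open>b * ln b\<close> is nonnegative and increasing, so the
      number of blocks may be replaced by the number of clusters.\<close>
    have B: "real b * ln (real b) \<le> real ?B * ln (real ?B)" "real ?B * ln (real ?B) \<ge> 0"
      using r(4,5) by (auto intro!: mult_mono mult_nonneg_nonneg)
    show ?thesis
    proof (cases "?N = 0")
      case True
      then have "word_length thompson_V S x = 0"
        using num_carets_eq_0[OF x] group.word_length_one[OF group_V] by simp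
      then show ?thesis using True B(2) \<open>K > 0\<close> by simp
    next
      case False
      have "real k \<le> 2 / ln 2 * ln (real b)" using r(6) by (simp add: log_def)
      then have "2 * real b * real k \<le> 2 * real b * (2 / ln 2 * ln (real b))"
        by (intro mult_left_mono) auto
      also have "\<dots> = 4 / ln 2 * (real b * ln (real b))" by simp
      also have "\<dots> \<le> 4 / ln 2 * (real ?B * ln (real ?B))" by (intro mult_left_mono B) auto
      finally have "real (102 * (?N + 1) + 2 * b * k) \<le>
          204 * real ?N + 4 / ln 2 * (real ?B * ln (real ?B))" using False by simp
      also have "\<dots> \<le> (204 + 4 / ln 2) * (real ?N + real ?B * ln (real ?B))"
        using B(2) by (simp add: algebra_simps)
      finally have *: "real (102 * (?N + 1) + 2 * b * k) \<le> \<dots>" .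
      have "word_length thompson_V S x \<le> M * (102 * (?N + 1) + 2 * b * k)" using M x r(1-3) by blast
      then have "real (word_length thompson_V S x) \<le> real M * real (102 * (?N + 1) + 2 * b * k)"
        by (metis of_nat_le_iff of_nat_mult)
      also have "\<dots> \<le> real M * ((204 + 4 / ln 2) * (real ?N + real ?B * ln (real ?B)))"
        by (rule mult_left_mono[OF *]) simp
      also have "\<dots> \<le> K * (real ?N + real ?B * ln (real ?B))"
        unfolding mult.assoc[symmetric] by (rule mult_right_mono) (use B(2) in \<open>auto simp: K_def\<close>)
      finally show ?thesis .
    qed
  qed
  ultimately show ?thesis by blast
qed

end
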